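(* Let $k:\mathbb{R}^d\times\mathbb{R}^d\to\mathbb{R}$ be given by $k(\mathbf{x},\mathbf{y})=\psi(\mathbf{x}-\mathbf{y})$, where $\psi:\mathbb{R}^d\to\mathbb{R}$ is bounded, continuous and positive definite with $\psi(0)=1$, and let $\Lambda$ be the associated Borel probability measure on $\mathbb{R}^d$. Suppose $\sigma^2:=\int_{\mathbb{R}^d}\|\boldsymbol{\omega}\|_2^2\,d\Lambda(\boldsymbol{\omega})<\infty$. Let $m\ge 1$ and let $\hat k$ be the random Fourier feature approximation of $k$ built from $(\boldsymbol{\omega}_i)_{i=1}^m$ drawn i.i.d. from $\Lambda$. Then for any $1\le r<\infty$, $\tau>0$ and any non-empty compact set $S\subset\mathbb{R}^d$, $$\Lambda^m\left(\left\{(\boldsymbol{\omega}_i)_{i=1}^m:\ \|\hat k-k\|_{L^r(S)}\ \ge\ \left(\frac{\pi^{d/2}|S|^d}{2^d\,\Gamma(\frac d2+1)}\right)^{2/r}\frac{h(d,|S|,\sigma)+\sqrt{2\tau}}{\sqrt m}\right\}\right)\le e^{-\tau},$$ where $$\|\hat k-k\|_{L^r(S)}:=\left(\int_S\int_S|\hat k(\mathbf{x},\mathbf{y})-k(\mathbf{x},\mathbf{y})|^r\,d\mathbf{x}\,d\mathbf{y}\right)^{1/r}$$ and $$h(d,|S|,\sigma):=32\sqrt{2d\log(2|S|+1)}+32\sqrt{2d\log(\sigma+1)}+16\sqrt{2d\,[\log(2|S|+1)]^{-1}}.$$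
   Context: Here $d\ge 1$, $\log$ is the natural logarithm, and $\Gamma$ is the Gamma function. By Bochner's theorem, a bounded continuous positive definite $\psi:\mathbb{R}^d\to\mathbb{R}$ with $\psi(0)=1$ is the Fourier transform of a unique Borel probability measure $\Lambda$ on $\mathbb{R}^d$: $\psi(\mathbf{z})=\int e^{\sqrt{-1}\,\boldsymbol{\omega}^T\mathbf{z}}\,d\Lambda(\boldsymbol{\omega})=\int\cos(\boldsymbol{\omega}^T\mathbf{z})\,d\Lambda(\boldsymbol{\omega})$. Given $\boldsymbol{\omega}_1,\dots,\boldsymbol{\omega}_m\in\mathbb{R}^d$, the random Fourier feature approximation is $\hat k(\mathbf{x},\mathbf{y})=\frac1m\sum_{i=1}^m\cos(\boldsymbol{\omega}_i^T(\mathbf{x}-\mathbf{y}))$. $\Lambda^m$ is the $m$-fold product measure, $\sigma\ge 0$ is the square root of $\sigma^2$, and $|S|=\sup\{\|\mathbf{x}-\mathbf{y}\|_2:\mathbf{x},\mathbf{y}\in S\}$ is the Euclidean diameter. Integrals over $S$ are with respect to Lebesgue measure.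
   Formalization: The set S is additionally assumed to have positive diameter |S| > 0; for a single-point S the term [log(2|S|+1)]^{-1} in h is 1/0, so the stated bound is undefined there. *)

theory Defs
  imports "HOL-Probability.Probability"
begin

text \<open>The coefficients are complex, as in Bochner's theorem; for real-valued
  \<open>\<psi>\<close> this forces \<open>\<psi>\<close> to be even, which real coefficients alone would not.\<close>

definition positive_definite :: "('a::real_vector \<Rightarrow> real) \<Rightarrow> bool" where
  "positive_definite \<psi> \<longleftrightarrow>
     (\<forall>(n::nat) (x::nat \<Rightarrow> 'a) (c::nat \<Rightarrow> complex).
        (\<Sum>i<n. \<Sum>j<n. c i * cnj (c j) * complex_of_real (\<psi> (x i - x j))) \<in> \<real>\<^sub>\<ge>\<^sub>0)"

definition measure_fourier :: "'a::real_inner measure \<Rightarrow> 'a \<Rightarrow> complex" where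
  "measure_fourier \<Lambda> z = (LINT \<omega>|\<Lambda>. exp (\<i> * complex_of_real (\<omega> \<bullet> z)))"

text \<open>The equation is between complex numbers, so the imaginary part of the transform of
  \<open>\<Lambda>\<close> vanishes; this makes \<open>\<Lambda>\<close> unique. The cosine integral alone would determine it only
  up to symmetrization.\<close>

definition bochner_measure :: "('a::euclidean_space \<Rightarrow> real) \<Rightarrow> 'a measure \<Rightarrow> bool" where
  "bochner_measure \<psi> \<Lambda> \<longleftrightarrow>
     prob_space \<Lambda> \<and> sets \<Lambda> = sets borel \<and>
     (\<forall>z. complex_of_real (\<psi> z) = measure_fourier \<Lambda> z)"

definition rff :: "nat \<Rightarrow> (nat \<Rightarrow> 'a::real_inner) \<Rightarrow> 'a \<Rightarrow> 'a \<Rightarrow> real" where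
  "rff m \<omega> x y = (1 / real m) * (\<Sum>i=1..m. cos (\<omega> i \<bullet> (x - y)))"

definition Lr_norm_on :: "real \<Rightarrow> 'a::euclidean_space set \<Rightarrow> ('a \<Rightarrow> 'a \<Rightarrow> real) \<Rightarrow> real" where
  "Lr_norm_on r S f =
     (LINT y:S|lborel. (LINT x:S|lborel. \<bar>f x y\<bar> powr r)) powr (1 / r)"

text \<open>The last summand is meaningful only for \<open>D > 0\<close>: at \<open>D = 0\<close> the logarithm is zero.\<close>

definition rff_h :: "nat \<Rightarrow> real \<Rightarrow> real \<Rightarrow> real" where
  "rff_h d D s =
     32 * sqrt (2 * real d * ln (2 * D + 1)) +
     32 * sqrt (2 * real d * ln (s + 1)) +
     16 * sqrt (2 * real d * inverse (ln (2 * D + 1)))"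

end

theory Submission
  imports Defs
begin

text \<open>
  Put \<open>D = |S|\<close> and \<open>F = sup |k_hat - k|\<close>, the supremum of the error over \<open>x - y\<close> in the
  ball of radius \<open>D\<close>. The isodiametric inequality (by Steiner symmetrization) bounds the volume of
  \<open>S\<close> by that of a ball of radius \<open>D/2\<close>, so the \<open>L\<^sup>r\<close> norm is at most \<open>F\<close> times the constant of
  the theorem. Replacing one frequency changes \<open>F\<close> by at most \<open>2/m\<close>, so McDiarmid's inequality with
  its sharp constant yields the term \<open>sqrt (2 \<tau> / m)\<close>. The mean of \<open>F\<close> is compared with a
  Rademacher average, which is bounded conditionally on the frequencies by dyadic chaining in the ball. The
  nets have mesh \<open>2\<^sup>-\<^sup>k / (1 + \<sigma>)\<close> independently of the sample, and the chaining bound is kept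
  affine in the empirical second moment, so that only its mean \<open>\<sigma>\<^sup>2\<close> enters.
\<close>

section \<open>The isodiametric inequality\<close>

text \<open>The constant of the theorem is a power of the volume of a ball of diameter |S|. A ball
  containing \<open>S\<close> may need a larger radius than |S|/2, so volumes cannot be compared by
  inclusion and the isodiametric inequality is required. Chaining yields sqrt(2d) times 12 a + 12 b
  + 28, where a and b are the square roots of ln (2 D + 1) and ln (sigma + 1). The absolute constant
  28 has no counterpart in \<open>rff_h\<close>; it is absorbed through 28 <= 20 a + 16 / a. The
  reciprocal logarithm thus does its work for small diameters, where a alone is too small. The
  Lipschitz constants of the sample paths are governed by the norms of the frequencies, which are
  unbounded and have only a second moment. Exponents tuned to each sample would put random
  quantities under square roots. They are therefore fixed before the sample is drawn, and the
  remainder beyond the finest net costs a first moment that vanishes in the limit.\<close>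

lemma nn_integral_lborel_shift:
  fixes f :: "'a::euclidean_space \<Rightarrow> ennreal"
  assumes [measurable]: "f \<in> borel_measurable borel"
  shows "(\<integral>\<^sup>+x. f (c + x) \<partial>lborel) = (\<integral>\<^sup>+x. f x \<partial>lborel)"
proof -
  have "(\<integral>\<^sup>+x. f x \<partial>lborel) = (\<integral>\<^sup>+x. f x \<partial>distr lborel borel ((+) c))"
    by (simp add: lborel_distr_plus)
  also have "\<dots> = (\<integral>\<^sup>+x. f (c + x) \<partial>lborel)"
    by (subst nn_integral_distr) auto
  finally show ?thesis by simp
qed

text \<open>Parametrized by every point \<open>x\<close> rather than by the hyperplane orthogonal to
  \<open>b\<close>: moving \<open>x\<close> along \<open>b\<close> merely translates the
  fibre.\<close>

definition fibre :: "'a::euclidean_space set \<Rightarrow> 'a \<Rightarrow> 'a \<Rightarrow> real set" where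
  "fibre S b x = {t. x + t *\<^sub>R b \<in> S}"

text \<open>For a unit vector \<open>b\<close> this is the Steiner symmetral in the hyperplane
  orthogonal to \<open>b\<close>. Fibre length is constant along \<open>b\<close>, so each line
  parallel to \<open>b\<close> meets the set in an open segment centred on the hyperplane and as
  long as the original fibre. The strict inequality discards lines with a null fibre, in particular
  those that miss \<open>S\<close>.\<close>

definition steiner :: "'a::euclidean_space set \<Rightarrow> 'a \<Rightarrow> 'a set" where
  "steiner S b = {x. ennreal (2 * \<bar>x \<bullet> b\<bar>) < emeasure lborel (fibre S b x)}"

lemma fibre_sets [measurable]: 
  assumes [measurable]: "S \<in> sets borel" shows "fibre S b x \<in> sets borel"
  unfolding fibre_def by measurable

lemma fibre_emeasure_measurable [measurable]:
  fixes S :: "'a::euclidean_space set"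
  assumes [measurable]: "S \<in> sets borel"
  shows "(\<lambda>x. emeasure lborel (fibre S b x)) \<in> borel_measurable borel"
proof -
  have 1: "(\<lambda>p. fst p + snd p *\<^sub>R b) \<in> (borel :: 'a measure) \<Otimes>\<^sub>M (lborel :: real measure) \<rightarrow>\<^sub>M borel"
    by measurable
  have "{p \<in> space ((borel::'a measure) \<Otimes>\<^sub>M (lborel::real measure)). fst p + snd p *\<^sub>R b \<in> S} \<in> sets ((borel :: 'a measure) \<Otimes>\<^sub>M (lborel :: real measure))"
    using measurable_sets_Collect[OF 1, of "\<lambda>x. x \<in> S"] by simp
  from lborel.measurable_emeasure_Pair[OF this]
  show ?thesis by (simp add: fibre_def vimage_def space_pair_measure)
qed

lemma emeasure_fibre_shift:
  assumes [measurable]: "S \<in> sets borel"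
  shows "emeasure lborel (fibre S b (x + s *\<^sub>R b)) = emeasure lborel (fibre S b x)"
proof -
  have "emeasure lborel (fibre S b x) = (\<integral>\<^sup>+t. indicator (fibre S b x) t \<partial>lborel)"
    by (subst nn_integral_indicator) auto
  also have "\<dots> = (\<integral>\<^sup>+t. indicator (fibre S b x) (s + t) \<partial>lborel)"
    by (rule nn_integral_lborel_shift[symmetric]) auto
  also have "\<dots> = (\<integral>\<^sup>+t. indicator (fibre S b (x + s *\<^sub>R b)) t \<partial>lborel)"
    by (intro nn_integral_cong) (auto simp: fibre_def indicator_def algebra_simps)
  finally show ?thesis by (subst (asm) nn_integral_indicator) auto
qed

lemma steiner_sets [measurable]:
  assumes [measurable]: "S \<in> sets borel" shows "steiner S b \<in> sets borel"
  unfolding steiner_def by measurable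

lemma emeasure_slab_fibres:
  fixes S :: "'a::euclidean_space set"
  assumes [measurable]: "S \<in> sets borel" and b: "b \<in> Basis"
  shows "emeasure lborel S = (\<integral>\<^sup>+x. indicator {0..1} (x \<bullet> b) * emeasure lborel (fibre S b x) \<partial>lborel)"
proof -
  have bb: "b \<bullet> b = 1" using b by (simp)
  txt \<open>Weighting the unit slab \<open>0 \<le> x \<bullet> b \<le> 1\<close> and applying Tonelli to the translations along \<open>b\<close>
    avoids splitting the space into \<open>b\<close> and its orthogonal complement.\<close>
  let ?g = "\<lambda>x::'a. indicator {0..1} (x \<bullet> b) :: ennreal"
  have g1: "(\<integral>\<^sup>+t. ?g (x - t *\<^sub>R b) \<partial>lborel) = 1" for x
  proof -
    have "(\<integral>\<^sup>+t. ?g (x - t *\<^sub>R b) \<partial>lborel) = (\<integral>\<^sup>+t. indicator {x \<bullet> b - 1..x \<bullet> b} t \<partial>lborel)"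
      by (intro nn_integral_cong) (auto simp: indicator_def inner_diff_left bb)
    then show ?thesis by simp
  qed
  have "emeasure lborel S = (\<integral>\<^sup>+x. indicator S x * (\<integral>\<^sup>+t. ?g (x - t *\<^sub>R b) \<partial>lborel) \<partial>lborel)"
    by (simp add: g1)
  also have "\<dots> = (\<integral>\<^sup>+x. (\<integral>\<^sup>+t. indicator S x * ?g (x - t *\<^sub>R b) \<partial>lborel) \<partial>lborel)"
    by (subst nn_integral_cmult) auto
  also have "\<dots> = (\<integral>\<^sup>+t. (\<integral>\<^sup>+x. indicator S x * ?g (x - t *\<^sub>R b) \<partial>lborel) \<partial>lborel)"
    by (rule lborel_pair.Fubini'[symmetric]) measurable
  also have "\<dots> = (\<integral>\<^sup>+t. (\<integral>\<^sup>+x. indicator S (x + t *\<^sub>R b) * ?g x \<partial>lborel) \<partial>lborel)"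
  proof (rule nn_integral_cong)
    fix t :: real
    show "(\<integral>\<^sup>+x. indicator S x * ?g (x - t *\<^sub>R b) \<partial>lborel) = (\<integral>\<^sup>+x. indicator S (x + t *\<^sub>R b) * ?g x \<partial>lborel)"
      using nn_integral_lborel_shift[of "\<lambda>x. indicator S x * ?g (x - t *\<^sub>R b)" "t *\<^sub>R b"]
      by (simp add: add.commute)
  qed
  also have "\<dots> = (\<integral>\<^sup>+x. (\<integral>\<^sup>+t. indicator S (x + t *\<^sub>R b) * ?g x \<partial>lborel) \<partial>lborel)"
    by (rule lborel_pair.Fubini') measurable
  also have "\<dots> = (\<integral>\<^sup>+x. ?g x * emeasure lborel (fibre S b x) \<partial>lborel)"
  proof (rule nn_integral_cong)
    fix x :: 'a
    have "(\<integral>\<^sup>+t. indicator S (x + t *\<^sub>R b) * ?g x \<partial>lborel) = (\<integral>\<^sup>+t. ?g x * indicator (fibre S b x) t \<partial>lborel)"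
      by (intro nn_integral_cong) (auto simp: fibre_def indicator_def)
    also have "\<dots> = ?g x * emeasure lborel (fibre S b x)"
      by (subst nn_integral_cmult) auto
    finally show "(\<integral>\<^sup>+t. indicator S (x + t *\<^sub>R b) * ?g x \<partial>lborel) = ?g x * emeasure lborel (fibre S b x)" .
  qed
  finally show ?thesis .
qed

lemma bounded_fibre:
  assumes "bounded S" "b \<in> Basis" shows "bounded (fibre S b x)"
proof -
  obtain B where B: "\<And>y. y \<in> S \<Longrightarrow> norm y \<le> B" using assms(1) unfolding bounded_iff by blast
  have "norm t \<le> B + norm x" if "t \<in> fibre S b x" for t
  proof -
    have "norm (t *\<^sub>R b) \<le> norm (x + t *\<^sub>R b) + norm x" 
      using norm_triangle_ineq4[of "x + t *\<^sub>R b" x] by simp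
    then show ?thesis using B[of "x + t *\<^sub>R b"] that assms(2) by (simp add: fibre_def)
  qed
  then show ?thesis unfolding bounded_iff by blast
qed

text \<open>Cavalieri: fibres of \<open>S\<close> and of its symmetral have equal length over every
  point, and \<open>emeasure_slab_fibres\<close> recovers the volume from these lengths. Boundedness
  makes the length finite, so that the new fibre is a bounded interval.\<close>

lemma emeasure_steiner:
  fixes S :: "'a::euclidean_space set"
  assumes [measurable]: "S \<in> sets borel" and S: "bounded S" and b: "b \<in> Basis"
  shows "emeasure lborel (steiner S b) = emeasure lborel S"
proof -
  have bb: "b \<bullet> b = 1" using b by simp
  have "emeasure lborel (fibre (steiner S b) b x) = emeasure lborel (fibre S b x)" for x
  proof -
    have "emeasure lborel (fibre S b x) < \<infinity>"
      using bounded_fibre[OF S b] by (metis emeasure_bounded_finite)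
    then obtain l where l: "l \<ge> 0" "emeasure lborel (fibre S b x) = ennreal l"
      by (cases "emeasure lborel (fibre S b x)") auto
    have "fibre (steiner S b) b x = {- (x \<bullet> b) - l/2 <..< - (x \<bullet> b) + l/2}"
    proof -
      have "t \<in> fibre (steiner S b) b x \<longleftrightarrow> 2 * \<bar>x \<bullet> b + t\<bar> < l" for t
        using l(1) unfolding fibre_def[of "steiner S b"] by (simp add: steiner_def emeasure_fibre_shift l(2) inner_add_left bb ennreal_less_iff)
      moreover have "2 * \<bar>x \<bullet> b + t\<bar> < l \<longleftrightarrow> t \<in> {- (x \<bullet> b) - l/2 <..< - (x \<bullet> b) + l/2}" for t
        proof -
        have "2 * \<bar>x \<bullet> b + t\<bar> < l \<longleftrightarrow> \<bar>x \<bullet> b + t\<bar> < l/2" by (simp add: field_simps)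
        also have "\<dots> \<longleftrightarrow> t < - (x \<bullet> b) + l/2 \<and> - (x \<bullet> b) - l/2 < t"
          unfolding abs_less_iff by (intro conj_cong iffI) auto
        finally show ?thesis by (simp add: conj_commute)
      qed
      ultimately show ?thesis by blast
    qed
    then show ?thesis using l by (simp)
  qed
  then show ?thesis
    unfolding emeasure_slab_fibres[OF assms(1) b] emeasure_slab_fibres[OF steiner_sets[OF assms(1), of b] b]
    by (intro nn_integral_cong) simp
qed

text \<open>Only the component along \<open>b\<close> changes. The heights \<open>p\<close> and
  \<open>q\<close> are smaller in absolute value than half the lengths of the original fibres
  \<open>X\<close> and \<open>Y\<close>, so those fibres contain points at least
  \<open>\<bar>p - q\<bar>\<close> apart along \<open>b\<close>; Pythagoras then compares the
  distances.\<close>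

lemma dist_steiner:
  fixes S :: "'a::euclidean_space set"
  assumes [measurable]: "S \<in> sets borel" and S: "bounded S" and b: "b \<in> Basis"
    and D: "\<And>x y. x \<in> S \<Longrightarrow> y \<in> S \<Longrightarrow> dist x y \<le> D"
    and xy: "x \<in> steiner S b" "y \<in> steiner S b"
  shows "dist x y \<le> D"
proof -
  have bb: "b \<bullet> b = 1" using b by simp
  define p q where "p = x \<bullet> b" and "q = y \<bullet> b"
  define x0 y0 where "x0 = x - p *\<^sub>R b" and "y0 = y - q *\<^sub>R b"
  have o: "x0 \<bullet> b = 0" "y0 \<bullet> b = 0" by (simp_all add: x0_def y0_def p_def q_def inner_diff_left bb)
  define X Y where "X = fibre S b x0" and "Y = fibre S b y0"
  have lx: "ennreal (2 * \<bar>p\<bar>) < emeasure lborel X"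
    using xy(1) emeasure_fibre_shift[of S b x "-p"] by (simp add: steiner_def X_def x0_def p_def)
  have ly: "ennreal (2 * \<bar>q\<bar>) < emeasure lborel Y"
    using xy(2) emeasure_fibre_shift[of S b y "-q"] by (simp add: steiner_def Y_def y0_def q_def)
  have bX: "bdd_above X" "bdd_below X" and bY: "bdd_above Y" "bdd_below Y"
    using bounded_fibre[OF S b] by (auto simp: X_def Y_def bounded_imp_bdd_above bounded_imp_bdd_below)
  have ne: "X \<noteq> {}" "Y \<noteq> {}" using lx ly by auto
  have len: "2 * r < Sup Z - Inf Z" if "ennreal (2 * r) < emeasure lborel Z" "bdd_above Z" "bdd_below Z" "Z \<noteq> {}" "r \<ge> 0" for r :: real and Z
  proof -
    have le: "Inf Z \<le> Sup Z" using that by (metis cInf_le_cSup)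
    have "Z \<subseteq> {Inf Z..Sup Z}" using that by (auto intro: cInf_lower cSup_upper)
    then have "emeasure lborel Z \<le> ennreal (Sup Z - Inf Z)"
      using emeasure_mono[of Z "{Inf Z..Sup Z}" lborel] le by simp
    with that(1) have "ennreal (2 * r) < ennreal (Sup Z - Inf Z)" by (rule less_le_trans)
    then show ?thesis using that(5) by (simp add: ennreal_less_iff)
  qed
  \<comment> \<open>Otherwise both \<open>Sup X - Inf Y\<close> and \<open>Sup Y - Inf X\<close> are
    at most \<open>\<bar>p - q\<bar>\<close>. Their sum is the total extent of \<open>X\<close> and
    \<open>Y\<close>, which exceeds 2 |p| + 2 |q|.\<close>
  have "\<exists>t\<in>X. \<exists>u\<in>Y. \<bar>p - q\<bar> \<le> \<bar>t - u\<bar>"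
  proof (rule ccontr)
    assume "\<not> ?thesis"
    then have c: "\<And>t u. t \<in> X \<Longrightarrow> u \<in> Y \<Longrightarrow> \<bar>t - u\<bar> < \<bar>p - q\<bar>" by force
    have "Sup X \<le> Inf Y + \<bar>p - q\<bar>"
    proof (rule cSup_least[OF ne(1)])
      fix t assume t: "t \<in> X"
      have "t - \<bar>p - q\<bar> \<le> Inf Y" by (rule cInf_greatest[OF ne(2)]) (use c[OF t] in force)
      then show "t \<le> Inf Y + \<bar>p - q\<bar>" by simp
    qed
    moreover have "Sup Y \<le> Inf X + \<bar>p - q\<bar>"
    proof (rule cSup_least[OF ne(2)])
      fix t assume t: "t \<in> Y"
      have "t - \<bar>p - q\<bar> \<le> Inf X" by (rule cInf_greatest[OF ne(1)]) (use c[OF _ t] in force)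
      then show "t \<le> Inf X + \<bar>p - q\<bar>" by simp
    qed
    ultimately show False
      using len[OF lx bX ne(1)] len[OF ly bY ne(2)] by simp
  qed
  then obtain t u where tu: "t \<in> X" "u \<in> Y" "\<bar>p - q\<bar> \<le> \<bar>t - u\<bar>" by blast
  have pyth: "(norm ((x0 + v *\<^sub>R b) - (y0 + w *\<^sub>R b)))\<^sup>2 = (norm (x0 - y0))\<^sup>2 + (v - w)\<^sup>2" for v w
  proof -
    have "(x0 + v *\<^sub>R b) - (y0 + w *\<^sub>R b) = (x0 - y0) + (v - w) *\<^sub>R b" by (simp add: algebra_simps)
    moreover have "orthogonal (x0 - y0) ((v - w) *\<^sub>R b)" using o by (simp add: orthogonal_def inner_diff_left)
    ultimately show ?thesis using b by (simp only: norm_add_Pythagorean) (simp add: power_mult_distrib)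
  qed
  have "(norm (x - y))\<^sup>2 = (norm (x0 - y0))\<^sup>2 + (p - q)\<^sup>2"
    using pyth[of p q] by (simp add: x0_def y0_def)
  also have "\<dots> \<le> (norm (x0 - y0))\<^sup>2 + (t - u)\<^sup>2" using tu(3) by (simp add: abs_le_square_iff)
  also have "\<dots> = (norm ((x0 + t *\<^sub>R b) - (y0 + u *\<^sub>R b)))\<^sup>2" by (rule pyth[symmetric])
  finally have "norm (x - y) \<le> norm ((x0 + t *\<^sub>R b) - (y0 + u *\<^sub>R b))"
    by (rule power2_le_imp_le) simp
  also have "\<dots> \<le> D" using D tu(1,2) by (simp add: X_def Y_def fibre_def dist_norm)
  finally show ?thesis by (simp add: dist_norm)
qed

section \<open>Central symmetry from reflections in the coordinate hyperplanes\<close>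

definition reflect :: "'a::euclidean_space \<Rightarrow> 'a \<Rightarrow> 'a" where
  "reflect e x = x - (2 * (x \<bullet> e)) *\<^sub>R e"

lemma steiner_reflect_self:
  assumes [measurable]: "S \<in> sets borel" and b: "b \<in> Basis" and x: "x \<in> steiner S b"
  shows "reflect b x \<in> steiner S b"
  using x emeasure_fibre_shift[of S b x "- 2 * (x \<bullet> b)"] b
  by (simp add: steiner_def reflect_def inner_diff_left)

text \<open>Reflection along \<open>e\<close> commutes with translation along the orthogonal
  \<open>b\<close>, so a point and its mirror image have the same fibre. Symmetries gained earlier
  thus survive later symmetrizations.\<close>

lemma steiner_reflect_other:
  assumes "b \<in> Basis" "e \<in> Basis" "e \<noteq> b" and S: "\<And>x. x \<in> S \<Longrightarrow> reflect e x \<in> S" and x: "x \<in> steiner S b"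
  shows "reflect e x \<in> steiner S b"
proof -
  have eb: "e \<bullet> b = 0" "b \<bullet> e = 0" "e \<bullet> e = 1" using assms(1-3) by (auto simp: inner_Basis)
  have rr: "reflect e (reflect e y) = y" for y by (simp add: reflect_def inner_diff_left eb)
  have S': "reflect e y \<in> S \<longleftrightarrow> y \<in> S" for y using S[of y] S[of "reflect e y"] rr by auto
  have "reflect e x + t *\<^sub>R b = reflect e (x + t *\<^sub>R b)" for t
    by (simp add: reflect_def inner_add_left eb)
  then have "fibre S b (reflect e x) = fibre S b x" by (simp add: fibre_def S')
  then show ?thesis using x by (simp add: steiner_def reflect_def inner_diff_left eb)
qed

lemma iterated_steiner:
  fixes S :: "'a::euclidean_space set"
  assumes "S \<in> sets borel" "bounded S" "\<And>x y. x \<in> S \<Longrightarrow> y \<in> S \<Longrightarrow> dist x y \<le> D"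
    and "A \<subseteq> Basis"
  shows "\<exists>T::'a set. T \<in> sets borel \<and> emeasure lborel T = emeasure lborel S \<and> (\<forall>x\<in>T. \<forall>y\<in>T. dist x y \<le> D)
     \<and> (\<forall>e\<in>A. \<forall>x\<in>T. reflect e x \<in> T)"
  using finite_subset[OF assms(4) finite_Basis] assms(4)
proof (induction A rule: finite_induct)
  case empty
  show ?case by (intro exI[of _ S]) (use assms(1,3) in simp)
next
  case (insert b A)
  then obtain T where T: "T \<in> sets borel" "emeasure lborel T = emeasure lborel S" "\<And>x y. x \<in> T \<Longrightarrow> y \<in> T \<Longrightarrow> dist x y \<le> D"
     "\<And>e x. e \<in> A \<Longrightarrow> x \<in> T \<Longrightarrow> reflect e x \<in> T" by auto
  \<comment> \<open>Boundedness is not carried through the induction; the bound on distances implies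
    it.\<close>
  have bT: "bounded T"
    using T(3) by (metis bounded_def)
  have bB: "b \<in> Basis" using insert.prems by auto
  show ?case
  proof (intro exI[of _ "steiner T b"] conjI ballI)
    show "steiner T b \<in> sets borel" using T(1) by measurable
    show "emeasure lborel (steiner T b) = emeasure lborel S"
      using emeasure_steiner[OF T(1) bT bB] T(2) by simp
    show "dist x y \<le> D" if "x \<in> steiner T b" "y \<in> steiner T b" for x y
      using dist_steiner[OF T(1) bT bB T(3) that] by simp
    show "reflect e x \<in> steiner T b" if "e \<in> insert b A" "x \<in> steiner T b" for e x
    proof (cases "e = b")
      case True
      then show ?thesis using steiner_reflect_self[OF T(1) bB] that by simp
    next
      case False
      then have "e \<in> A" "e \<in> Basis" using that insert.prems by auto
      then show ?thesis using steiner_reflect_other[OF bB \<open>e \<in> Basis\<close> False T(4)] that by simp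
    qed
  qed
qed

text \<open>The reflections along all basis vectors compose to x -> -x, so the fully symmetrized set
  \<open>T\<close> is centrally symmetric. Then 2 |x| = dist x (-x) <= D for its points, which puts
  \<open>T\<close> inside the ball of radius D/2.\<close>

theorem isodiametric_inequality:
  fixes S :: "'a::euclidean_space set"
  assumes "S \<in> sets borel" "bounded S"
  shows "measure lborel S \<le> measure lborel (cball (0::'a) (diameter S / 2))"
proof -
  define D where "D = diameter S"
  have "\<And>x y. x \<in> S \<Longrightarrow> y \<in> S \<Longrightarrow> dist x y \<le> D"
    using diameter_bounded_bound[OF assms(2)] D_def by auto
  from iterated_steiner[OF assms this order_refl]
  obtain T :: "'a set" where T: "T \<in> sets borel" "emeasure lborel T = emeasure lborel S" "\<And>x y. x \<in> T \<Longrightarrow> y \<in> T \<Longrightarrow> dist x y \<le> D"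
     "\<And>e x. e \<in> Basis \<Longrightarrow> x \<in> T \<Longrightarrow> reflect e x \<in> T" by metis
  have "x - (\<Sum>e\<in>A. (2 * (x \<bullet> e)) *\<^sub>R e) \<in> T" if "A \<subseteq> Basis" "x \<in> T" for A x
    using finite_subset[OF that(1) finite_Basis] that(1)
  proof (induction A rule: finite_induct)
    case (insert b A)
    have bB: "b \<in> Basis" "A \<subseteq> Basis" using insert.prems by auto
    have "(\<Sum>e\<in>A. (2 * (x \<bullet> e)) *\<^sub>R e) \<bullet> b = (\<Sum>e\<in>A. 0)"
      unfolding inner_sum_left using bB insert.hyps
      by (intro sum.cong) (auto simp: inner_Basis subset_iff)
    then have "reflect b (x - (\<Sum>e\<in>A. (2 * (x \<bullet> e)) *\<^sub>R e)) = x - (\<Sum>e\<in>insert b A. (2 * (x \<bullet> e)) *\<^sub>R e)"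
      using insert.hyps by (simp add: reflect_def inner_diff_left)
    then show ?case using T(4)[OF bB(1) insert.IH[OF bB(2)]] by simp
  qed (use that in simp)
  from this[OF order_refl] have "- x \<in> T" if "x \<in> T" for x
  proof -
    have "x - (\<Sum>e\<in>Basis. (2 * (x \<bullet> e)) *\<^sub>R e) = x - 2 *\<^sub>R (\<Sum>e\<in>Basis. (x \<bullet> e) *\<^sub>R e)"
      by (simp add: scaleR_right.sum)
    also have "\<dots> = - x" unfolding euclidean_representation by (simp add: scaleR_2)
    finally show ?thesis using \<open>\<And>x. x \<in> T \<Longrightarrow> x - _ \<in> T\<close>[OF that] by simp
  qed
  then have "2 * norm x \<le> D" if "x \<in> T" for x
    using T(3)[of x "- x"] that by (simp add: dist_norm flip: scaleR_2)
  then have "T \<subseteq> cball 0 (D / 2)" by force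
  then have "emeasure lborel S \<le> emeasure lborel (cball (0::'a) (D/2))"
    unfolding T(2)[symmetric] by (intro emeasure_mono) auto
  then show ?thesis unfolding D_def measure_def
    by (intro enn2real_mono) (use emeasure_bounded_finite[OF bounded_cball, of "0::'a" "diameter S / 2"] in auto)
qed

section \<open>Rademacher averages and chaining\<close>

lemma cosh_le_exp_half_square: "(exp x + exp (- x)) / 2 \<le> exp (x\<^sup>2 / 2)" for x :: real
proof -
  have pos: "(exp x + exp (- x)) / 2 \<le> exp (x\<^sup>2 / 2)" if "x \<ge> 0" for x :: real
  proof -
    have p: "1 + (exp (2 * x) - 1) / 2 > 0" by (simp add: add_pos_pos field_simps)
    \<comment> \<open>Hoeffding's estimate for a fair coin at the argument \<open>2 * x\<close>: its
      bound h^2 / 8 becomes x^2 / 2, and the left side is the logarithm of cosh x.\<close>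
    have "- x + ln (1 + (exp (2 * x) - 1) / 2) \<le> x\<^sup>2 / 2"
      using Hoeffdings_lemma_aux[of "2 * x" "1 / 2"] that by (simp add: power_mult_distrib)
    then have "exp (- x + ln (1 + (exp (2 * x) - 1) / 2)) \<le> exp (x\<^sup>2 / 2)" by simp
    also have "exp (- x + ln (1 + (exp (2 * x) - 1) / 2)) = exp (- x) * (1 + (exp (2 * x) - 1) / 2)"
      using p by (subst exp_add) simp
    also have "\<dots> = (exp x + exp (- x)) / 2"
      by (simp add: algebra_simps add_divide_distrib diff_divide_distrib mult_exp_exp)
    finally show ?thesis .
  qed
  show ?thesis using pos[of x] pos[of "- x"] by (cases "x \<ge> 0") (auto simp: add.commute)
qed

text \<open>A sign pattern is encoded by the set \<open>U\<close> of indices carrying +1. The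
  Rademacher expectation is then the finite average \<open>sign_avg\<close> over
  \<open>Pow I\<close>, and no second probability space enters.\<close>

definition sgn_of :: "'i set \<Rightarrow> 'i \<Rightarrow> real" where
  "sgn_of U i = (if i \<in> U then 1 else -1)"

definition sign_avg :: "'i set \<Rightarrow> ('i set \<Rightarrow> real) \<Rightarrow> real" where
  "sign_avg I f = (\<Sum>U\<in>Pow I. f U) / 2 ^ card I"

lemma sign_avg_mono: "(\<And>U. U \<subseteq> I \<Longrightarrow> f U \<le> g U) \<Longrightarrow> sign_avg I f \<le> sign_avg I g"
  unfolding sign_avg_def by (intro divide_right_mono sum_mono) auto

lemma sign_avg_add: "sign_avg I (\<lambda>U. f U + g U) = sign_avg I f + sign_avg I g"
  by (simp add: sign_avg_def sum.distrib add_divide_distrib)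

lemma sign_avg_cmult: "sign_avg I (\<lambda>U. c * f U) = c * sign_avg I f"
  by (simp add: sign_avg_def sum_distrib_left)

lemma sign_avg_sum: "sign_avg I (\<lambda>U. \<Sum>k\<in>A. f k U) = (\<Sum>k\<in>A. sign_avg I (f k))"
  unfolding sign_avg_def by (subst sum.swap) (simp add: sum_divide_distrib)

lemma sign_avg_const: "finite I \<Longrightarrow> sign_avg I (\<lambda>U. c) = c"
  by (simp add: sign_avg_def card_Pow)

text \<open>Independence of the signs appears as the expansion \<open>prod_add\<close> of a product
  of binary sums over all subsets; each factor is a hyperbolic cosine.\<close>

lemma sign_avg_mgf:
  assumes "finite I"
  shows "sign_avg I (\<lambda>U. exp (l * (\<Sum>i\<in>I. sgn_of U i * a i))) \<le> exp (l\<^sup>2 * (\<Sum>i\<in>I. (a i)\<^sup>2) / 2)"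
proof -
  have e: "exp (l * (\<Sum>i\<in>I. sgn_of U i * a i)) = (\<Prod>i\<in>U. exp (l * a i)) * (\<Prod>i\<in>I-U. exp (- (l * a i)))"
    if "U \<in> Pow I" for U
  proof -
    have U: "U \<subseteq> I" using that by auto
    have "l * (\<Sum>i\<in>I. sgn_of U i * a i) = (\<Sum>i\<in>I-U. l * (sgn_of U i * a i)) + (\<Sum>i\<in>U. l * (sgn_of U i * a i))"
      unfolding sum_distrib_left by (rule sum.subset_diff[OF U assms])
    also have "\<dots> = (\<Sum>i\<in>I-U. - (l * a i)) + (\<Sum>i\<in>U. l * a i)"
      by (intro arg_cong2[where f="(+)"] sum.cong) (auto simp: sgn_of_def)
    finally have "l * (\<Sum>i\<in>I. sgn_of U i * a i) = (\<Sum>i\<in>U. l * a i) + (\<Sum>i\<in>I-U. - (l * a i))"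
      by simp
    then show ?thesis using assms U by (simp add: exp_add exp_sum finite_subset)
  qed
  have "sign_avg I (\<lambda>U. exp (l * (\<Sum>i\<in>I. sgn_of U i * a i))) = (\<Prod>i\<in>I. exp (l * a i) + exp (- (l * a i))) / 2 ^ card I"
    unfolding sign_avg_def prod_add[OF assms] by (intro arg_cong2[where f="(/)"] sum.cong refl e)
  also have "\<dots> = (\<Prod>i\<in>I. (exp (l * a i) + exp (- (l * a i))) / 2)"
    by (simp add: prod_dividef)
  also have "\<dots> \<le> (\<Prod>i\<in>I. exp ((l * a i)\<^sup>2 / 2))"
    by (intro prod_mono conjI cosh_le_exp_half_square) (simp add: add_nonneg_nonneg)
  also have "\<dots> = exp (l\<^sup>2 * (\<Sum>i\<in>I. (a i)\<^sup>2) / 2)"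
    using assms by (simp add: exp_sum[symmetric] power_mult_distrib sum_distrib_left sum_divide_distrib)
  finally show ?thesis .
qed

text \<open>The exponential-moment bound for a finite maximum, with the factor 2 paying for the
  absolute value. The parameter \<open>l\<close> stays free instead of being optimized, so that the
  bound is affine in the variance proxy \<open>v\<close>.\<close>

lemma sign_avg_Max_le:
  assumes I: "finite I" and T: "finite T" "T \<noteq> {}" and l: "l > 0"
    and v: "\<And>t. t \<in> T \<Longrightarrow> (\<Sum>i\<in>I. (a t i)\<^sup>2) \<le> v"
  shows "sign_avg I (\<lambda>U. MAX t\<in>T. \<bar>\<Sum>i\<in>I. sgn_of U i * a t i\<bar>) \<le> ln (2 * real (card T)) / l + l * v / 2"
proof -
  define X where "X U = (MAX t\<in>T. \<bar>\<Sum>i\<in>I. sgn_of U i * a t i\<bar>)" for U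
  define C where "C = 2 * real (card T) * exp (l\<^sup>2 * v / 2)"
  have cT: "card T > 0" using T by (simp add: card_gt_0_iff)
  then have C: "C > 0" by (simp add: C_def)
  have ex: "exp (l * X U) \<le> (\<Sum>t\<in>T. exp (l * (\<Sum>i\<in>I. sgn_of U i * a t i)) + exp ((-l) * (\<Sum>i\<in>I. sgn_of U i * a t i)))" for U
  proof -
    have "X U \<in> (\<lambda>t. \<bar>\<Sum>i\<in>I. sgn_of U i * a t i\<bar>) ` T" unfolding X_def using T by (intro Max_in) auto
    then obtain t where t: "t \<in> T" "X U = \<bar>\<Sum>i\<in>I. sgn_of U i * a t i\<bar>" by auto
    have "exp (l * X U) \<le> exp (l * (\<Sum>i\<in>I. sgn_of U i * a t i)) + exp ((-l) * (\<Sum>i\<in>I. sgn_of U i * a t i))"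
      unfolding t(2) by (cases "(\<Sum>i\<in>I. sgn_of U i * a t i) \<ge> 0") auto
    also have "\<dots> \<le> (\<Sum>t\<in>T. exp (l * (\<Sum>i\<in>I. sgn_of U i * a t i)) + exp ((-l) * (\<Sum>i\<in>I. sgn_of U i * a t i)))"
      by (rule member_le_sum[OF t(1) _ T(1), of "\<lambda>t. exp (l * (\<Sum>i\<in>I. sgn_of U i * a t i)) + exp ((-l) * (\<Sum>i\<in>I. sgn_of U i * a t i))"]) (simp add: add_nonneg_nonneg)
    finally show ?thesis .
  qed
  have "sign_avg I (\<lambda>U. exp (l * X U)) \<le> (\<Sum>t\<in>T. sign_avg I (\<lambda>U. exp (l * (\<Sum>i\<in>I. sgn_of U i * a t i))) + sign_avg I (\<lambda>U. exp ((-l) * (\<Sum>i\<in>I. sgn_of U i * a t i))))"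
    using sign_avg_mono[of I, OF ex] by (simp only: sign_avg_sum sign_avg_add)
  also have "\<dots> \<le> (\<Sum>t\<in>T. exp (l\<^sup>2 * v / 2) + exp (l\<^sup>2 * v / 2))"
  proof (intro sum_mono add_mono)
    fix t assume t: "t \<in> T"
    have e: "exp (l\<^sup>2 * (\<Sum>i\<in>I. (a t i)\<^sup>2) / 2) \<le> exp (l\<^sup>2 * v / 2)" using v[OF t] by (simp add: mult_left_mono)
    show "sign_avg I (\<lambda>U. exp (l * (\<Sum>i\<in>I. sgn_of U i * a t i))) \<le> exp (l\<^sup>2 * v / 2)"
      using sign_avg_mgf[OF I, of l "a t"] e by linarith
    show "sign_avg I (\<lambda>U. exp ((-l) * (\<Sum>i\<in>I. sgn_of U i * a t i))) \<le> exp (l\<^sup>2 * v / 2)"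
      by (rule order_trans[OF sign_avg_mgf[OF I, of "-l" "a t", unfolded power2_minus] e])
  qed
  also have "\<dots> = C" by (simp add: C_def)
  finally have avC: "sign_avg I (\<lambda>U. exp (l * X U)) \<le> C" .
  \<comment> \<open>The tangent to the logarithm at \<open>C\<close>, applied to
    \<open>exp (l * X U)\<close>. Being affine in the exponential, it can be averaged directly and
    replaces Jensen's inequality.\<close>
  have tan: "l * X U \<le> (ln C - 1) + (1 / C) * exp (l * X U)" for U
  proof -
    have "1 + (l * X U - ln C) \<le> exp (l * X U - ln C)" by (rule exp_ge_add_one_self)
    then show ?thesis using C by (simp add: exp_diff)
  qed
  have "l * sign_avg I X = sign_avg I (\<lambda>U. l * X U)" by (simp add: sign_avg_cmult)
  also have "\<dots> \<le> sign_avg I (\<lambda>U. (ln C - 1) + (1 / C) * exp (l * X U))"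
    by (rule sign_avg_mono[OF tan])
  also have "\<dots> = (ln C - 1) + (1 / C) * sign_avg I (\<lambda>U. exp (l * X U))"
    by (simp only: sign_avg_add sign_avg_cmult sign_avg_const[OF I])
  also have "\<dots> \<le> (ln C - 1) + (1 / C) * C" using avC C by (intro add_left_mono mult_left_mono) auto
  also have "\<dots> = ln (2 * real (card T)) + l\<^sup>2 * v / 2"
    using C cT unfolding C_def by (simp add: ln_mult)
  finally have "sign_avg I X \<le> (ln (2 * real (card T)) + l\<^sup>2 * v / 2) / l"
    using l by (simp add: pos_le_divide_eq mult.commute)
  also have "\<dots> = ln (2 * real (card T)) / l + l * v / 2"
    using l by (simp add: add_divide_distrib power2_eq_square)
  finally show ?thesis unfolding X_def .
qed

text \<open>Telescoping along approximations: a start in \<open>T 0\<close>, links between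
  consecutive nets, and a trivially bounded remainder below \<open>T K\<close>. The coefficients
  \<open>y\<close> are deterministic here. The nets lie in \<open>S\<close> and need not lie in the
  set \<open>Q\<close> of the supremum.\<close>

lemma dyadic_chaining:
  fixes y :: "'z::metric_space \<Rightarrow> 'i \<Rightarrow> real"
  assumes I: "finite I"
    and T: "\<And>k. finite (T k)" "\<And>k. T k \<noteq> {}" "\<And>k. T k \<subseteq> S"
    and cover: "\<And>k z. z \<in> S \<Longrightarrow> \<exists>t\<in>T k. dist z t \<le> \<delta> k"
    and y: "\<And>z i. z \<in> S \<Longrightarrow> i \<in> I \<Longrightarrow> \<bar>y z i\<bar> \<le> c"
    and lip: "\<And>z z' i. z \<in> S \<Longrightarrow> z' \<in> S \<Longrightarrow> i \<in> I \<Longrightarrow> \<bar>y z i - y z' i\<bar> \<le> dist z z' * b i"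
    and b: "\<And>i. i \<in> I \<Longrightarrow> b i \<ge> 0"
    and l: "\<And>k. l k > 0"
    and Q: "Q \<subseteq> S" "Q \<noteq> {}"
  shows "sign_avg I (\<lambda>U. SUP z\<in>Q. \<bar>\<Sum>i\<in>I. sgn_of U i * y z i\<bar>)
    \<le> ln (2 * real (card (T 0))) / l 0 + l 0 * (real (card I) * c\<^sup>2) / 2
      + (\<Sum>k<K. ln (2 * real (card (T (Suc k)))) / l (Suc k) + l (Suc k) * ((\<delta> k)\<^sup>2 * (\<Sum>i\<in>I. (b i)\<^sup>2)) / 2)
      + \<delta> K * (\<Sum>i\<in>I. b i)"
proof -
  define p where "p k z = (SOME t. t \<in> T k \<and> dist z t \<le> \<delta> k)" for k z
  have p: "p k z \<in> T k \<and> dist z (p k z) \<le> \<delta> k" if "z \<in> S" for k z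
    unfolding p_def by (rule someI_ex) (use cover[OF that] in blast)
  have pS: "p k z \<in> S" if "z \<in> S" for k z using p[OF that] T(3) by blast
  define R where "R U z = (\<Sum>i\<in>I. sgn_of U i * y z i)" for U z
  have Rd: "R U z - R U z' = (\<Sum>i\<in>I. sgn_of U i * (y z i - y z' i))" for U z z'
    by (simp add: R_def sum_subtractf algebra_simps)
  define M0 where "M0 U = (MAX t\<in>T 0. \<bar>R U t\<bar>)" for U
  \<comment> \<open>Every point of \<open>T (Suc k)\<close> has a single predecessor in
    \<open>T k\<close>, at distance at most \<open>\<delta> k\<close>, so the number of links is the
    cardinality of the finer net only.\<close>
  define M where "M k U = (MAX t\<in>T (Suc k). \<bar>R U t - R U (p k t)\<bar>)" for k U
  have chain: "\<bar>R U t\<bar> \<le> M0 U + (\<Sum>k<n. M k U)" if "t \<in> T n" for U t n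
    using that
  proof (induction n arbitrary: t)
    case 0
    then show ?case unfolding M0_def using T(1)[of 0] by simp
  next
    case (Suc n)
    then have tS: "t \<in> S" using T(3) by blast
    have "\<bar>R U (p n t)\<bar> \<le> M0 U + (\<Sum>k<n. M k U)" using p[OF tS] by (intro Suc.IH) auto
    moreover have "\<bar>R U t - R U (p n t)\<bar> \<le> M n U" unfolding M_def using T(1)[of "Suc n"] Suc.prems by simp
    ultimately show ?case by simp
  qed
  have sup: "(SUP z\<in>Q. \<bar>R U z\<bar>) \<le> M0 U + (\<Sum>k<K. M k U) + \<delta> K * (\<Sum>i\<in>I. b i)" for U
  proof (rule cSUP_least[OF Q(2)])
    fix z assume "z \<in> Q"
    then have z: "z \<in> S" using Q by auto
    have "\<bar>R U z - R U (p K z)\<bar> \<le> (\<Sum>i\<in>I. \<bar>sgn_of U i * (y z i - y (p K z) i)\<bar>)"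
      unfolding Rd by (rule sum_abs)
    also have "\<dots> \<le> (\<Sum>i\<in>I. \<delta> K * b i)"
    proof (rule sum_mono)
      fix i assume i: "i \<in> I"
      have "\<bar>sgn_of U i * (y z i - y (p K z) i)\<bar> = \<bar>y z i - y (p K z) i\<bar>"
        by (auto simp: sgn_of_def abs_minus_commute)
      also have "\<dots> \<le> dist z (p K z) * b i" by (rule lip[OF z pS[OF z] i])
      also have "\<dots> \<le> \<delta> K * b i" using p[OF z, of K] b[OF i] by (intro mult_right_mono) auto
      finally show "\<bar>sgn_of U i * (y z i - y (p K z) i)\<bar> \<le> \<delta> K * b i" .
    qed
    finally have "\<bar>R U z - R U (p K z)\<bar> \<le> \<delta> K * (\<Sum>i\<in>I. b i)" by (simp add: sum_distrib_left)
    moreover have "\<bar>R U (p K z)\<bar> \<le> M0 U + (\<Sum>k<K. M k U)" using p[OF z] by (intro chain) auto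
    ultimately show "\<bar>R U z\<bar> \<le> M0 U + (\<Sum>k<K. M k U) + \<delta> K * (\<Sum>i\<in>I. b i)" by linarith
  qed
  have "sign_avg I (\<lambda>U. SUP z\<in>Q. \<bar>R U z\<bar>) \<le> sign_avg I (\<lambda>U. M0 U + (\<Sum>k<K. M k U) + \<delta> K * (\<Sum>i\<in>I. b i))"
    by (rule sign_avg_mono[OF sup])
  also have "\<dots> = sign_avg I M0 + (\<Sum>k<K. sign_avg I (M k)) + \<delta> K * (\<Sum>i\<in>I. b i)"
    by (simp only: sign_avg_add sign_avg_sum sign_avg_const[OF I])
  also have "\<dots> \<le> (ln (2 * real (card (T 0))) / l 0 + l 0 * (real (card I) * c\<^sup>2) / 2)
      + (\<Sum>k<K. ln (2 * real (card (T (Suc k)))) / l (Suc k) + l (Suc k) * ((\<delta> k)\<^sup>2 * (\<Sum>i\<in>I. (b i)\<^sup>2)) / 2)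
      + \<delta> K * (\<Sum>i\<in>I. b i)"
  proof (intro add_mono sum_mono order_refl)
    show "sign_avg I M0 \<le> ln (2 * real (card (T 0))) / l 0 + l 0 * (real (card I) * c\<^sup>2) / 2"
      unfolding M0_def R_def
    proof (rule sign_avg_Max_le[OF I T(1,2) l])
      fix t assume "t \<in> T 0"
      then have t: "t \<in> S" using T(3) by blast
      have "(\<Sum>i\<in>I. (y t i)\<^sup>2) \<le> (\<Sum>i\<in>I. c\<^sup>2)"
      proof (rule sum_mono)
        fix i assume "i \<in> I"
        from y[OF t this] show "(y t i)\<^sup>2 \<le> c\<^sup>2" by (metis abs_ge_zero power2_abs power_mono)
      qed
      then show "(\<Sum>i\<in>I. (y t i)\<^sup>2) \<le> real (card I) * c\<^sup>2" by simp
    qed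
    fix k
    show "sign_avg I (M k) \<le> ln (2 * real (card (T (Suc k)))) / l (Suc k) + l (Suc k) * ((\<delta> k)\<^sup>2 * (\<Sum>i\<in>I. (b i)\<^sup>2)) / 2"
      unfolding M_def Rd
    proof (rule sign_avg_Max_le[OF I T(1,2) l])
      fix t assume "t \<in> T (Suc k)"
      then have t: "t \<in> S" using T(3) by blast
      have "(\<Sum>i\<in>I. (y t i - y (p k t) i)\<^sup>2) \<le> (\<Sum>i\<in>I. (\<delta> k * b i)\<^sup>2)"
      proof (rule sum_mono)
        fix i assume i: "i \<in> I"
        have "\<bar>y t i - y (p k t) i\<bar> \<le> dist t (p k t) * b i" by (rule lip[OF t pS[OF t] i])
        also have "\<dots> \<le> \<delta> k * b i" using p[OF t, of k] b[OF i] by (intro mult_right_mono) auto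
        finally show "(y t i - y (p k t) i)\<^sup>2 \<le> (\<delta> k * b i)\<^sup>2" by (metis abs_ge_zero power2_abs power_mono)
      qed
      then show "(\<Sum>i\<in>I. (y t i - y (p k t) i)\<^sup>2) \<le> (\<delta> k)\<^sup>2 * (\<Sum>i\<in>I. (b i)\<^sup>2)"
        by (simp add: power_mult_distrib sum_distrib_left)
    qed
  qed
  finally show ?thesis by (simp add: R_def add.assoc)
qed

section \<open>Covering numbers of Euclidean balls\<close>

lemma card_separated_le:
  fixes P :: "'a::euclidean_space set"
  assumes D: "D \<ge> 0" and e: "e > 0" and P: "finite P" "P \<subseteq> cball 0 D"
    and sep: "\<And>s t. s \<in> P \<Longrightarrow> t \<in> P \<Longrightarrow> s \<noteq> t \<Longrightarrow> dist s t > e"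
  shows "real (card P) \<le> (1 + 2 * D / e) ^ DIM('a)"
proof -
  define V where "V = unit_ball_vol (real DIM('a))"
  have V: "V > 0" by (simp add: V_def)
  \<comment> \<open>Packing by volume: balls of radius e/2 around separated points are disjoint and
    fit into the ball of radius D + e/2.\<close>
  have disj: "disjoint_family_on (\<lambda>t. ball t (e / 2)) P"
    unfolding disjoint_family_on_def
  proof safe
    fix s t x assume "s \<in> P" "t \<in> P" "s \<noteq> t" "x \<in> ball s (e / 2)" "x \<in> ball t (e / 2)"
    with sep[of s t] dist_triangle2[of s t x] show "x \<in> {}" by (auto simp: dist_commute)
  qed
  have "real (card P) * (V * (e / 2) ^ DIM('a)) = (\<Sum>t\<in>P. measure lborel (ball t (e / 2)))"
    using e by (simp add: content_ball V_def)
  also have "\<dots> = measure lborel (\<Union>t\<in>P. ball t (e / 2))"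
    by (rule measure_finite_Union[symmetric, OF P(1) _ disj])
       (use emeasure_bounded_finite[OF bounded_ball] in \<open>auto simp: less_top\<close>)
  also have "\<dots> \<le> measure lborel (ball (0::'a) (D + e / 2))"
  proof (rule measure_mono_fmeasurable)
    show "(\<Union>t\<in>P. ball t (e / 2)) \<subseteq> ball 0 (D + e / 2)"
    proof safe
      fix t x assume "t \<in> P" "x \<in> ball t (e / 2)"
      with P(2) show "x \<in> ball 0 (D + e / 2)"
        using dist_triangle[of 0 x t] by auto
    qed
    show "ball 0 (D + e / 2) \<in> fmeasurable lborel"
      by (rule fmeasurableI) (use emeasure_bounded_finite[OF bounded_ball] in auto)
  qed (use P in auto)
  also have "\<dots> = V * (D + e / 2) ^ DIM('a)" using D e by (simp add: content_ball V_def)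
  also have "\<dots> = V * (e / 2) ^ DIM('a) * (1 + 2 * D / e) ^ DIM('a)"
  proof -
    have "e / 2 * (1 + 2 * D / e) = D + e / 2" using e by (simp add: field_simps)
    then show ?thesis by (simp only: power_mult_distrib[symmetric] mult.assoc)
  qed
  finally have "(V * (e / 2) ^ DIM('a)) * real (card P) \<le> (V * (e / 2) ^ DIM('a)) * (1 + 2 * D / e) ^ DIM('a)"
    by (simp only: mult_ac)
  then show ?thesis using V e by (simp only: mult_le_cancel_left_pos[OF mult_pos_pos[OF V zero_less_power[OF half_gt_zero[OF e]]]])
qed

text \<open>A separated set of largest cardinality is a net, since an uncovered point could be added
  to it. The packing bound guarantees that a largest one exists and also bounds its size.\<close>

lemma cball_net:
  fixes D e :: real
  assumes D: "D \<ge> 0" and e: "e > 0"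
  obtains T :: "'a::euclidean_space set" where "finite T" "T \<noteq> {}" "T \<subseteq> cball 0 D"
    "\<And>z. z \<in> cball 0 D \<Longrightarrow> \<exists>t\<in>T. dist z t \<le> e" "real (card T) \<le> (1 + 2 * D / e) ^ DIM('a)"
proof -
  define sep where "sep P \<longleftrightarrow> finite P \<and> P \<subseteq> cball (0::'a) D \<and> (\<forall>s\<in>P. \<forall>t\<in>P. s \<noteq> t \<longrightarrow> dist s t > e)" for P
  have bnd: "real (card P) \<le> (1 + 2 * D / e) ^ DIM('a)" if "sep P" for P
    using that unfolding sep_def by (intro card_separated_le[OF D e]) auto
  have "\<forall>P. sep P \<longrightarrow> card P < Suc (nat \<lfloor>(1 + 2 * D / e) ^ DIM('a)\<rfloor>)"
    using bnd by (simp add: le_nat_floor less_Suc_eq_le)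
  moreover have "sep {}" by (simp add: sep_def)
  ultimately obtain T where T: "sep T" "\<And>P. sep P \<Longrightarrow> card P \<le> card T"
    using ex_has_greatest_nat[of sep "{}" card] by (metis less_Suc_eq_le)
  have fT: "finite T" using T(1) by (simp add: sep_def)
  have cov: "\<exists>t\<in>T. dist z t \<le> e" if z: "z \<in> cball 0 D" for z
  proof (rule ccontr)
    assume "\<not> ?thesis"
    then have far: "\<And>t. t \<in> T \<Longrightarrow> dist z t > e" by force
    then have "z \<notin> T" using e by force
    moreover have "sep (insert z T)" using T(1) z far by (auto simp: sep_def dist_commute)
    ultimately show False using T(2)[of "insert z T"] fT by simp
  qed
  moreover have "T \<noteq> {}" using cov[of 0] D by auto
  ultimately show ?thesis using that T(1) bnd[OF T(1)] unfolding sep_def by blast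
qed

section \<open>Bounded differences and empirical processes\<close>

text \<open>An oscillation of at most \<open>c\<close> confines \<open>f\<close> to an interval of
  length \<open>c\<close> above its infimum. Stating the lemma by oscillation suits bounded
  differences, where no fixed interval is known, and keeps the sharp factor 1/8.\<close>

lemma (in prob_space) hoeffding_mgf:
  fixes f :: "'a \<Rightarrow> real"
  assumes [measurable]: "f \<in> borel_measurable M" and l: "l > 0"
    and bd: "\<And>x. x \<in> space M \<Longrightarrow> \<bar>f x\<bar> \<le> B"
    and osc: "\<And>x y. x \<in> space M \<Longrightarrow> y \<in> space M \<Longrightarrow> f x - f y \<le> c"
  shows "expectation (\<lambda>x. exp (l * (f x - expectation f))) \<le> exp (l\<^sup>2 * c\<^sup>2 / 8)"
proof -
  define a where "a = (INF x\<in>space M. f x)"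
  have bb: "bdd_below (f ` space M)"
    by (rule bdd_belowI2[of _ "-B"]) (use bd in force)
  have lo: "a \<le> f x" if "x \<in> space M" for x
    unfolding a_def by (rule cINF_lower[OF bb that])
  have hi: "f x \<le> a + c" if x: "x \<in> space M" for x
  proof -
    have "f x - c \<le> a" unfolding a_def
      by (rule cINF_greatest[OF not_empty]) (use osc[OF x] in force)
    then show ?thesis by simp
  qed
  interpret interval_bounded_random_variable M f a "a + c"
    by unfold_locales (use lo hi in auto)
  have "nn_integral M (\<lambda>x. exp (l * (f x - expectation f))) \<le> ennreal (exp (l\<^sup>2 * c\<^sup>2 / 8))"
    using Hoeffdings_lemma_nn_integral[OF l] by simp
  moreover have "integrable M (\<lambda>x. exp (l * (f x - expectation f)))"
  proof (rule integrable_const_bound[where B="exp (l * (B - expectation f))"])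
    show "AE x in M. norm (exp (l * (f x - expectation f))) \<le> exp (l * (B - expectation f))"
      using bd l by (intro AE_I2) (force simp: abs_le_iff)
  qed measurable
  ultimately have "ennreal (expectation (\<lambda>x. exp (l * (f x - expectation f)))) \<le> ennreal (exp (l\<^sup>2 * c\<^sup>2 / 8))"
    by (subst nn_integral_eq_integral[symmetric]) auto
  then show ?thesis by (simp add: ennreal_le_iff)
qed

text \<open>The martingale argument as an induction on coordinates: \<open>G\<close> averages out
  the new coordinate, has the same mean as \<open>F\<close>, and inherits both its bound and its
  differences. Hence \<open>F\<close> is arbitrary in the induction.\<close>

lemma bounded_differences_mgf:
  fixes M :: "'a measure" and F :: "('i \<Rightarrow> 'a) \<Rightarrow> real"
  assumes M: "prob_space M" and "finite I" and "F \<in> borel_measurable (Pi\<^sub>M I (\<lambda>_. M))" and l: "l > 0"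
    and "\<And>w. w \<in> space (Pi\<^sub>M I (\<lambda>_. M)) \<Longrightarrow> \<bar>F w\<bar> \<le> B"
    and "\<And>w i x. w \<in> space (Pi\<^sub>M I (\<lambda>_. M)) \<Longrightarrow> i \<in> I \<Longrightarrow> x \<in> space M \<Longrightarrow> \<bar>F (w(i := x)) - F w\<bar> \<le> c"
  shows "(\<integral>w. exp (l * (F w - (\<integral>w. F w \<partial>Pi\<^sub>M I (\<lambda>_. M)))) \<partial>Pi\<^sub>M I (\<lambda>_. M)) \<le> exp (l\<^sup>2 * real (card I) * c\<^sup>2 / 8)"
  using assms(2,3,5,6)
proof (induction I arbitrary: F rule: finite_induct)
  case empty
  show ?case by (simp add: PiM_empty lebesgue_integral_count_space_finite)
next
  case (insert i I)
  interpret prob_space M by (rule M)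
  interpret P: product_sigma_finite "\<lambda>_::'i. M" ..
  interpret PI: prob_space "Pi\<^sub>M I (\<lambda>_::'i. M)" by (intro prob_space_PiM M)
  interpret PJ: prob_space "Pi\<^sub>M (insert i I) (\<lambda>_::'i. M)" by (intro prob_space_PiM M)
  let ?P = "Pi\<^sub>M I (\<lambda>_. M)" and ?J = "Pi\<^sub>M (insert i I) (\<lambda>_. M)"
  note [measurable] = insert.prems(1)
  define G where "G w = (\<integral>x. F (w(i := x)) \<partial>M)" for w
  define mu where "mu = (\<integral>w. F w \<partial>?J)"
  have upd: "w(i := x) \<in> space ?J" if "w \<in> space ?P" "x \<in> space M" for w x
    using that insert.hyps by (auto simp: space_PiM PiE_iff extensional_def)
  have m2: "(\<lambda>(w, x). F (w(i := x))) \<in> borel_measurable (?P \<Otimes>\<^sub>M M)"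
    using measurable_compose[OF measurable_add_dim insert.prems(1)] by (simp add: split_beta')
  have m1: "(\<lambda>x. F (w(i := x))) \<in> borel_measurable M" if "w \<in> space ?P" for w
    using measurable_Pair2[OF m2 that] by simp
  have Gm [measurable]: "G \<in> borel_measurable ?P"
    unfolding G_def by (rule borel_measurable_lebesgue_integral[OF m2])
  have Fi: "integrable M (\<lambda>x. F (w(i := x)))" if "w \<in> space ?P" for w
    by (rule integrable_const_bound[where B=B]) (use m1[OF that] insert.prems(2) upd[OF that] in auto)
  have Gb: "\<bar>G w\<bar> \<le> B" if w: "w \<in> space ?P" for w
  proof -
    have "norm (G w) \<le> (\<integral>x. norm (F (w(i := x))) \<partial>M)" unfolding G_def by (rule integral_norm_bound)
    also have "\<dots> \<le> (\<integral>x. B \<partial>M)"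
      by (intro integral_mono integrable_norm Fi w) (use insert.prems(2) upd[OF w] in auto)
    finally show ?thesis by (simp add: prob_space)
  qed
  have Gd: "\<bar>G (w(j := x)) - G w\<bar> \<le> c" if w: "w \<in> space ?P" and j: "j \<in> I" and x: "x \<in> space M" for w j x
  proof -
    have w': "w(j := x) \<in> space ?P" using w j x by (auto simp: space_PiM PiE_iff extensional_def)
    have ji: "i \<noteq> j" using j insert.hyps by auto
    have "G (w(j := x)) - G w = (\<integral>y. F ((w(i := y))(j := x)) - F (w(i := y)) \<partial>M)"
      unfolding G_def using Fi[OF w] Fi[OF w'] by (simp add: fun_upd_twist[OF ji])
    also have "norm \<dots> \<le> (\<integral>y. norm (F ((w(i := y))(j := x)) - F (w(i := y))) \<partial>M)" by (rule integral_norm_bound)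
    also have "\<dots> \<le> (\<integral>y. c \<partial>M)"
    proof (intro integral_mono integrable_norm Bochner_Integration.integrable_diff)
      show "integrable M (\<lambda>y. F ((w(i := y))(j := x)))" using Fi[OF w'] by (simp add: fun_upd_twist[OF ji])
      show "norm (F ((w(i := y))(j := x)) - F (w(i := y))) \<le> c" if "y \<in> space M" for y
        unfolding real_norm_def by (rule insert.prems(3)[OF upd[OF w that] insertI2[OF j] x])
    qed (use Fi[OF w] in auto)
    finally show ?thesis by (simp add: prob_space)
  qed
  have FJ: "integrable ?J F"
    by (rule PJ.integrable_const_bound[where B=B]) (use insert.prems(2) in auto)
  have mu: "mu = (\<integral>w. G w \<partial>?P)"
    unfolding mu_def G_def by (rule P.product_integral_insert[OF insert.hyps FJ])
  have ex: "integrable ?J (\<lambda>w. exp (l * (F w - mu)))"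
  proof (rule PJ.integrable_const_bound[where B="exp (l * (B - mu))"])
    show "AE x in ?J. norm (exp (l * (F x - mu))) \<le> exp (l * (B - mu))"
      using insert.prems(2) l by (intro AE_I2) (force simp: abs_le_iff)
  qed measurable
  \<comment> \<open>With the other coordinates frozen, \<open>G w\<close> is the mean over the new
    coordinate and the oscillation is at most \<open>c\<close>, so \<open>hoeffding_mgf\<close>
    contributes one factor per coordinate.\<close>
  have inner: "(\<integral>x. exp (l * (F (w(i := x)) - mu)) \<partial>M) \<le> exp (l\<^sup>2 * c\<^sup>2 / 8) * exp (l * (G w - mu))" if w: "w \<in> space ?P" for w
  proof -
    have "(\<integral>x. exp (l * (F (w(i := x)) - G w)) \<partial>M) \<le> exp (l\<^sup>2 * c\<^sup>2 / 8)"
      unfolding G_def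
    proof (rule hoeffding_mgf[OF m1[OF w] l, of B])
      show "\<bar>F (w(i := x))\<bar> \<le> B" if "x \<in> space M" for x using insert.prems(2) upd[OF w that] by auto
      show "F (w(i := x)) - F (w(i := y)) \<le> c" if "x \<in> space M" "y \<in> space M" for x y
        by (rule abs_le_D1[OF insert.prems(3)[OF upd[OF w that(2)] insertI1 that(1), unfolded fun_upd_upd]])
    qed
    moreover have "(\<integral>x. exp (l * (F (w(i := x)) - mu)) \<partial>M) = (\<integral>x. exp (l * (G w - mu)) * exp (l * (F (w(i := x)) - G w)) \<partial>M)"
      by (simp add: mult_exp_exp algebra_simps)
    ultimately show ?thesis by (simp add: mult.commute)
  qed
  have eG: "integrable ?P (\<lambda>w. exp (l * (G w - mu)))"
  proof (rule PI.integrable_const_bound[where B="exp (l * (B - mu))"])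
    show "AE x in ?P. norm (exp (l * (G x - mu))) \<le> exp (l * (B - mu))"
      using Gb l by (intro AE_I2) (force simp: abs_le_iff)
  qed measurable
  have "(\<integral>w. exp (l * (F w - mu)) \<partial>?J) = (\<integral>w. (\<integral>x. exp (l * (F (w(i := x)) - mu)) \<partial>M) \<partial>?P)"
    by (rule P.product_integral_insert[OF insert.hyps ex])
  also have "\<dots> \<le> (\<integral>w. exp (l\<^sup>2 * c\<^sup>2 / 8) * exp (l * (G w - mu)) \<partial>?P)"
    by (rule integral_mono') (use inner eG in auto)
  also have "\<dots> = exp (l\<^sup>2 * c\<^sup>2 / 8) * (\<integral>w. exp (l * (G w - mu)) \<partial>?P)" by simp
  also have "\<dots> \<le> exp (l\<^sup>2 * c\<^sup>2 / 8) * exp (l\<^sup>2 * real (card I) * c\<^sup>2 / 8)"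
    unfolding mu by (intro mult_left_mono insert.IH Gm Gb Gd) auto
  also have "\<dots> = exp (l\<^sup>2 * real (card (insert i I)) * c\<^sup>2 / 8)"
    using insert.hyps by (simp add: mult_exp_exp algebra_simps add_divide_distrib)
  finally show ?case unfolding mu_def .
qed

theorem mcdiarmid:
  fixes M :: "'a measure" and F :: "('i \<Rightarrow> 'a) \<Rightarrow> real"
  assumes M: "prob_space M" and I: "finite I" "I \<noteq> {}" and F [measurable]: "F \<in> borel_measurable (Pi\<^sub>M I (\<lambda>_. M))"
    and c: "c > 0" and t: "t > 0"
    and bd: "\<And>w. w \<in> space (Pi\<^sub>M I (\<lambda>_. M)) \<Longrightarrow> \<bar>F w\<bar> \<le> B"
    and diff: "\<And>w i x. w \<in> space (Pi\<^sub>M I (\<lambda>_. M)) \<Longrightarrow> i \<in> I \<Longrightarrow> x \<in> space M \<Longrightarrow> \<bar>F (w(i := x)) - F w\<bar> \<le> c"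
  shows "measure (Pi\<^sub>M I (\<lambda>_. M)) {w \<in> space (Pi\<^sub>M I (\<lambda>_. M)). (\<integral>w. F w \<partial>Pi\<^sub>M I (\<lambda>_. M)) + t \<le> F w}
           \<le> exp (- 2 * t\<^sup>2 / (real (card I) * c\<^sup>2))"
proof -
  let ?P = "Pi\<^sub>M I (\<lambda>_. M)"
  interpret prob_space ?P by (intro prob_space_PiM M)
  define n where "n = real (card I)"
  have n: "n > 0" using I by (simp add: n_def card_gt_0_iff)
  \<comment> \<open>The minimizer of l^2 n c^2 / 8 - l t, with minimum -2 t^2 / (n c^2).\<close>
  define l where "l = 4 * t / (n * c\<^sup>2)"
  have l: "l > 0" using t n c by (simp add: l_def)
  define mu where "mu = (\<integral>w. F w \<partial>?P)"
  have ex: "integrable ?P (\<lambda>w. exp (l * (F w - mu)))"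
  proof (rule integrable_const_bound[where B="exp (l * (B - mu))"])
    show "AE x in ?P. norm (exp (l * (F x - mu))) \<le> exp (l * (B - mu))"
      using bd l by (intro AE_I2) (force simp: abs_le_iff)
  qed measurable
  have "prob {w \<in> space ?P. mu + t \<le> F w} = prob {w \<in> space ?P. exp (l * t) \<le> exp (l * (F w - mu))}"
    using l by (intro arg_cong[where f=prob] Collect_cong) auto
  also have "\<dots> \<le> expectation (\<lambda>w. exp (l * (F w - mu))) / exp (l * t)"
    using integral_Markov_inequality_measure[OF ex, of "space ?P" "exp (l * t)"] by simp
  also have "\<dots> \<le> exp (l\<^sup>2 * n * c\<^sup>2 / 8) / exp (l * t)"
    unfolding mu_def n_def using bounded_differences_mgf[OF M I(1) F l bd diff] by (intro divide_right_mono) auto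
  also have "\<dots> = exp (l\<^sup>2 * n * c\<^sup>2 / 8 - l * t)" by (simp add: exp_diff)
  also have "l\<^sup>2 * n * c\<^sup>2 / 8 - l * t = - 2 * t\<^sup>2 / (n * c\<^sup>2)"
    using n c unfolding l_def by (simp add: field_simps power2_eq_square)
  finally show ?thesis by (simp add: mu_def n_def)
qed

section \<open>Suprema of weighted empirical sums and symmetrization\<close>

definition emp_sup :: "'z set \<Rightarrow> ('z \<Rightarrow> 'a \<Rightarrow> real) \<Rightarrow> 'i set \<Rightarrow> ('i \<Rightarrow> real) \<Rightarrow> ('i \<Rightarrow> 'a) \<Rightarrow> real" where
  "emp_sup Q y I c w = (SUP z\<in>Q. \<bar>\<Sum>i\<in>I. c i * y z (w i)\<bar>)"

text \<open>Countability of \<open>Q\<close> makes the supremum measurable; the uniform bound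
  \<open>B\<close> makes it integrable on every finite product through a constant majorant.\<close>

locale empirical_process = prob_space M for M :: "'a measure" +
  fixes Q :: "'z set" and y :: "'z \<Rightarrow> 'a \<Rightarrow> real" and B :: real
  assumes Q: "countable Q" "Q \<noteq> {}"
    and y_meas [measurable]: "\<And>z. z \<in> Q \<Longrightarrow> y z \<in> borel_measurable M"
    and y_bd: "\<And>z x. z \<in> Q \<Longrightarrow> x \<in> space M \<Longrightarrow> \<bar>y z x\<bar> \<le> B"
begin

text \<open>The sample may be indexed by a set \<open>K\<close> larger than \<open>I\<close>,
  because symmetrization compares a block of the sum with the whole sum on one product
  space.\<close>

lemma abs_sum_le:
  assumes "w \<in> space (Pi\<^sub>M K (\<lambda>_. M))" "I \<subseteq> K" "z \<in> Q"
  shows "\<bar>\<Sum>i\<in>I. c i * y z (w i)\<bar> \<le> (\<Sum>i\<in>I. \<bar>c i\<bar>) * B"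
proof -
  have "\<bar>\<Sum>i\<in>I. c i * y z (w i)\<bar> \<le> (\<Sum>i\<in>I. \<bar>c i * y z (w i)\<bar>)" by (rule sum_abs)
  also have "\<dots> \<le> (\<Sum>i\<in>I. \<bar>c i\<bar> * B)"
    by (intro sum_mono) (use assms y_bd in \<open>auto simp: abs_mult space_PiM PiE_iff subset_iff intro!: mult_left_mono\<close>)
  finally show ?thesis by (simp add: sum_distrib_right)
qed

lemma emp_sup_bdd:
  assumes "w \<in> space (Pi\<^sub>M K (\<lambda>_. M))" "I \<subseteq> K"
  shows "bdd_above ((\<lambda>z. \<bar>\<Sum>i\<in>I. c i * y z (w i)\<bar>) ` Q)"
  by (rule bdd_aboveI2[OF abs_sum_le[OF assms]])

lemma emp_sup_upper:
  assumes "w \<in> space (Pi\<^sub>M K (\<lambda>_. M))" "I \<subseteq> K" "z \<in> Q"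
  shows "\<bar>\<Sum>i\<in>I. c i * y z (w i)\<bar> \<le> emp_sup Q y I c w"
  unfolding emp_sup_def by (rule cSUP_upper[OF assms(3) emp_sup_bdd[OF assms(1,2)]])

lemma emp_sup_least:
  assumes "\<And>z. z \<in> Q \<Longrightarrow> \<bar>\<Sum>i\<in>I. c i * y z (w i)\<bar> \<le> b"
  shows "emp_sup Q y I c w \<le> b"
  unfolding emp_sup_def by (rule cSUP_least[OF Q(2) assms])

lemma emp_sup_nonneg:
  assumes "w \<in> space (Pi\<^sub>M K (\<lambda>_. M))" "I \<subseteq> K"
  shows "0 \<le> emp_sup Q y I c w"
proof -
  obtain z where "z \<in> Q" using Q by auto
  from emp_sup_upper[OF assms this, of c] show ?thesis by linarith
qed

lemma emp_sup_abs:
  assumes "w \<in> space (Pi\<^sub>M K (\<lambda>_. M))" "I \<subseteq> K"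
  shows "\<bar>emp_sup Q y I c w\<bar> \<le> (\<Sum>i\<in>I. \<bar>c i\<bar>) * B"
  using emp_sup_nonneg[OF assms, of c] emp_sup_least[OF abs_sum_le[OF assms], of c] by simp

lemma emp_sup_measurable:
  assumes "I \<subseteq> K"
  shows "emp_sup Q y I c \<in> borel_measurable (Pi\<^sub>M K (\<lambda>_. M))"
proof -
  have [measurable]: "(\<lambda>w. w i) \<in> Pi\<^sub>M K (\<lambda>_. M) \<rightarrow>\<^sub>M M" if "i \<in> I" for i
    using that assms by (intro measurable_component_singleton) auto
  show ?thesis unfolding emp_sup_def
    by (rule borel_measurable_cSUP[OF Q(1)]) (use emp_sup_bdd[OF _ assms] in measurable)
qed

lemma emp_sup_integrable:
  assumes "I \<subseteq> K"
  shows "integrable (Pi\<^sub>M K (\<lambda>_. M)) (emp_sup Q y I c)"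
proof -
  interpret P: prob_space "Pi\<^sub>M K (\<lambda>_. M)" by (intro prob_space_PiM prob_space_axioms)
  show ?thesis
    by (rule P.integrable_const_bound[where B="(\<Sum>i\<in>I. \<bar>c i\<bar>) * B"])
       (use emp_sup_measurable[OF assms] emp_sup_abs[OF _ assms] in auto)
qed

end

locale centred_empirical_process = empirical_process +
  assumes centred: "\<And>z. z \<in> Q \<Longrightarrow> expectation (y z) = 0"
begin

text \<open>Jensen: the sum over \<open>J\<close> is the conditional mean of the sum over \<open>J \<union> K\<close>.\<close>

lemma expectation_emp_sup_mono:
  fixes J K :: "'i set"
  assumes JK: "J \<inter> K = {}" "finite J" "finite K"
  shows "(\<integral>w. emp_sup Q y J c w \<partial>Pi\<^sub>M (J \<union> K) (\<lambda>_. M)) \<le> (\<integral>w. emp_sup Q y (J \<union> K) c w \<partial>Pi\<^sub>M (J \<union> K) (\<lambda>_. M))"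
proof -
  interpret PS: product_sigma_finite "\<lambda>_::'i. M" ..
  let ?J = "Pi\<^sub>M J (\<lambda>_. M)" and ?K = "Pi\<^sub>M K (\<lambda>_. M)" and ?JK = "Pi\<^sub>M (J \<union> K) (\<lambda>_. M)"
  interpret PJ: prob_space ?J by (intro prob_space_PiM prob_space_axioms)
  interpret PK: prob_space ?K by (intro prob_space_PiM prob_space_axioms)
  interpret PP: product_prob_space "\<lambda>_::'i. M" K by unfold_locales
  have mg: "merge J K (x, v) \<in> space ?JK" if "x \<in> space ?J" "v \<in> space ?K" for x v
    using measurable_space[OF measurable_merge, of "(x, v)" J "\<lambda>_. M" K] that by (simp add: space_pair_measure)
  have sJ: "(\<Sum>i\<in>J. c i * y z (merge J K (x, v) i)) = (\<Sum>i\<in>J. c i * y z (x i))" for z x v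
    by (intro sum.cong) (auto simp: merge_def)
  have sK: "(\<Sum>i\<in>K. c i * y z (merge J K (x, v) i)) = (\<Sum>i\<in>K. c i * y z (v i))" for z x v
    using JK(1) by (intro sum.cong) (auto simp: merge_def)
  define H where "H x v = emp_sup Q y (J \<union> K) c (merge J K (x, v))" for x v
  define C where "C = (\<Sum>i\<in>J\<union>K. \<bar>c i\<bar>) * B"
  have Hm2: "(\<lambda>(x, v). H x v) \<in> borel_measurable (?J \<Otimes>\<^sub>M ?K)"
    using measurable_compose[OF measurable_merge emp_sup_measurable[OF order_refl, of "J \<union> K" c]]
    by (simp add: H_def split_beta')
  have Hb: "\<bar>H x v\<bar> \<le> C" if "x \<in> space ?J" "v \<in> space ?K" for x v
    unfolding H_def C_def by (rule emp_sup_abs[OF mg[OF that] order_refl])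
  have Hi: "integrable ?K (H x)" if x: "x \<in> space ?J" for x
    by (rule PK.integrable_const_bound[where B=C]) (use measurable_Pair2[OF Hm2 x] Hb[OF x] in auto)
  have IHi: "integrable ?J (\<lambda>x. \<integral>v. H x v \<partial>?K)"
  proof (rule PJ.integrable_const_bound[where B=C])
    show "(\<lambda>x. \<integral>v. H x v \<partial>?K) \<in> borel_measurable ?J"
      by (rule PK.borel_measurable_lebesgue_integral[OF Hm2])
    show "AE x in ?J. norm (\<integral>v. H x v \<partial>?K) \<le> C"
    proof (rule AE_I2)
      fix x assume x: "x \<in> space ?J"
      have "norm (\<integral>v. H x v \<partial>?K) \<le> (\<integral>v. norm (H x v) \<partial>?K)" by (rule integral_norm_bound)
      also have "\<dots> \<le> (\<integral>v. C \<partial>?K)"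
        by (intro integral_mono integrable_norm Hi x) (use Hb[OF x] in auto)
      finally show "norm (\<integral>v. H x v \<partial>?K) \<le> C" by (simp add: PK.prob_space)
    qed
  qed
  have z0: "(\<integral>v. (\<Sum>i\<in>K. c i * y z (v i)) \<partial>?K) = 0" and zi: "integrable ?K (\<lambda>v. (\<Sum>i\<in>K. c i * y z (v i)))"
    if z: "z \<in> Q" for z
  proof -
    have i: "integrable ?K (\<lambda>v. y z (v i))" if "i \<in> K" for i
      by (rule PK.integrable_const_bound[where B=B])
         (use y_bd[OF z] that z in \<open>auto simp: space_PiM PiE_iff\<close>)
    have "(\<integral>v. y z (v i) \<partial>?K) = 0" if "i \<in> K" for i
    proof -
      have "(\<integral>v. y z (v i) \<partial>?K) = integral\<^sup>L (distr ?K M (\<lambda>v. v i)) (y z)"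
        using that z by (subst integral_distr) auto
      also have "distr ?K M (\<lambda>v. v i) = M" by (rule PP.PiM_component[OF that])
      finally show ?thesis using centred[OF z] by simp
    qed
    with i show "(\<integral>v. (\<Sum>i\<in>K. c i * y z (v i)) \<partial>?K) = 0" by (simp add: Bochner_Integration.integral_sum)
    show "integrable ?K (\<lambda>v. (\<Sum>i\<in>K. c i * y z (v i)))" using i by (intro Bochner_Integration.integrable_sum) auto
  qed
  have "(\<integral>w. emp_sup Q y J c w \<partial>?JK) = (\<integral>x. (\<integral>v. emp_sup Q y J c (merge J K (x, v)) \<partial>?K) \<partial>?J)"
    by (rule PS.product_integral_fold[OF JK emp_sup_integrable]) auto
  also have "\<dots> = (\<integral>x. emp_sup Q y J c x \<partial>?J)"
    by (simp add: emp_sup_def sJ PK.prob_space)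
  also have "\<dots> \<le> (\<integral>x. (\<integral>v. H x v \<partial>?K) \<partial>?J)"
  proof (rule integral_mono[OF emp_sup_integrable[OF order_refl] IHi])
    fix x assume x: "x \<in> space ?J"
    show "emp_sup Q y J c x \<le> (\<integral>v. H x v \<partial>?K)"
    proof (rule emp_sup_least)
      fix z assume z: "z \<in> Q"
      have sJK: "(\<Sum>i\<in>J. c i * y z (x i)) + (\<Sum>i\<in>K. c i * y z (v i)) = (\<Sum>i\<in>J\<union>K. c i * y z (merge J K (x, v) i))" for v
        using sJ[of z x v] sK[of z x v] JK by (simp add: sum.union_disjoint)
      have "\<bar>\<Sum>i\<in>J. c i * y z (x i)\<bar> = \<bar>\<integral>v. (\<Sum>i\<in>J. c i * y z (x i)) + (\<Sum>i\<in>K. c i * y z (v i)) \<partial>?K\<bar>"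
        using zi[OF z] by (simp add: z0[OF z] PK.prob_space)
      also have "\<dots> \<le> (\<integral>v. \<bar>(\<Sum>i\<in>J. c i * y z (x i)) + (\<Sum>i\<in>K. c i * y z (v i))\<bar> \<partial>?K)"
        by (rule integral_abs_bound)
      also have "\<dots> \<le> (\<integral>v. H x v \<partial>?K)"
      proof (rule integral_mono)
        show "\<bar>(\<Sum>i\<in>J. c i * y z (x i)) + (\<Sum>i\<in>K. c i * y z (v i))\<bar> \<le> H x v" if "v \<in> space ?K" for v
          unfolding sJK H_def by (rule emp_sup_upper[OF mg[OF x that] order_refl z])
      qed (use zi[OF z] Hi[OF x] in auto)
      finally show "\<bar>\<Sum>i\<in>J. c i * y z (x i)\<bar> \<le> (\<integral>v. H x v \<partial>?K)" .
    qed
  qed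
  also have "\<dots> = (\<integral>w. emp_sup Q y (J \<union> K) c w \<partial>?JK)"
    unfolding H_def by (rule PS.product_integral_fold[OF JK emp_sup_integrable, symmetric]) auto
  finally show ?thesis .
qed

text \<open>Centring makes an independent copy of the sample unnecessary: each of the blocks \<open>U\<close> and \<open>I - U\<close>
  is dominated by the whole signed sum, which costs the factor 2.\<close>

lemma expectation_emp_sup_signs:
  fixes I U :: "'i set"
  assumes I: "finite I" and U: "U \<subseteq> I"
  shows "(\<integral>w. emp_sup Q y I (\<lambda>_. 1) w \<partial>Pi\<^sub>M I (\<lambda>_. M)) \<le> 2 * (\<integral>w. emp_sup Q y I (sgn_of U) w \<partial>Pi\<^sub>M I (\<lambda>_. M))"
proof -
  let ?P = "Pi\<^sub>M I (\<lambda>_. M)"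
  let ?c = "sgn_of U"
  have UI: "U \<union> (I - U) = I" "(I - U) \<union> U = I" using U by auto
  have fin: "finite U" "finite (I - U)" using I U by (auto intro: finite_subset)
  have "(\<integral>w. emp_sup Q y I (\<lambda>_. 1) w \<partial>?P) \<le> (\<integral>w. emp_sup Q y U ?c w + emp_sup Q y (I - U) ?c w \<partial>?P)"
  proof (rule integral_mono)
    fix w assume w: "w \<in> space ?P"
    show "emp_sup Q y I (\<lambda>_. 1) w \<le> emp_sup Q y U ?c w + emp_sup Q y (I - U) ?c w"
    proof (rule emp_sup_least)
      fix z assume z: "z \<in> Q"
      \<comment> \<open>The signs are -1 on \<open>I - U\<close>, so the unsigned sum is the
        difference of the two signed blocks.\<close>
      have "(\<Sum>i\<in>I. 1 * y z (w i)) = (\<Sum>i\<in>U. ?c i * y z (w i)) - (\<Sum>i\<in>I-U. ?c i * y z (w i))"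
        using sum.subset_diff[OF U I, of "\<lambda>i. y z (w i)"] by (simp add: sgn_of_def sum_negf)
      then show "\<bar>\<Sum>i\<in>I. 1 * y z (w i)\<bar> \<le> emp_sup Q y U ?c w + emp_sup Q y (I - U) ?c w"
        using emp_sup_upper[OF w U z, of ?c] emp_sup_upper[OF w _ z, of "I - U" ?c] by auto
    qed
  qed (use U in \<open>auto intro!: emp_sup_integrable Bochner_Integration.integrable_add\<close>)
  also have "\<dots> = (\<integral>w. emp_sup Q y U ?c w \<partial>?P) + (\<integral>w. emp_sup Q y (I - U) ?c w \<partial>?P)"
    using U by (intro Bochner_Integration.integral_add emp_sup_integrable) auto
  also have "\<dots> \<le> (\<integral>w. emp_sup Q y I ?c w \<partial>?P) + (\<integral>w. emp_sup Q y I ?c w \<partial>?P)"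
    using expectation_emp_sup_mono[of U "I - U" ?c] expectation_emp_sup_mono[of "I - U" U ?c] fin
    by (simp only: UI) (intro add_mono; auto)
  finally show ?thesis by simp
qed

end

section \<open>Random Fourier features\<close>

lemma (in prob_space) expectation_sum_PiM:
  fixes f :: "'a \<Rightarrow> real" and I :: "'i set"
  assumes f: "integrable M f" and I: "finite I"
  shows "integrable (Pi\<^sub>M I (\<lambda>_. M)) (\<lambda>w. \<Sum>i\<in>I. f (w i))"
    and "(\<integral>w. (\<Sum>i\<in>I. f (w i)) \<partial>Pi\<^sub>M I (\<lambda>_. M)) = real (card I) * expectation f"
proof -
  interpret PP: product_prob_space "\<lambda>_::'i. M" I by unfold_locales
  have i: "integrable (Pi\<^sub>M I (\<lambda>_. M)) (\<lambda>w. f (w i)) \<and> (\<integral>w. f (w i) \<partial>Pi\<^sub>M I (\<lambda>_. M)) = expectation f" if "i \<in> I" for i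
  proof -
    have d: "distr (Pi\<^sub>M I (\<lambda>_. M)) M (\<lambda>w. w i) = M" by (rule PP.PiM_component[OF that])
    have m: "(\<lambda>w. w i) \<in> Pi\<^sub>M I (\<lambda>_. M) \<rightarrow>\<^sub>M M" using that by measurable
    have fm: "f \<in> borel_measurable M" using f by auto
    from f have "integrable (distr (Pi\<^sub>M I (\<lambda>_. M)) M (\<lambda>w. w i)) f" by (simp only: d)
    moreover have "expectation f = integral\<^sup>L (distr (Pi\<^sub>M I (\<lambda>_. M)) M (\<lambda>w. w i)) f" by (simp only: d)
    ultimately show ?thesis using integrable_distr_eq[OF m fm] integral_distr[OF m fm] by simp
  qed
  then show "integrable (Pi\<^sub>M I (\<lambda>_. M)) (\<lambda>w. \<Sum>i\<in>I. f (w i))"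
    "(\<integral>w. (\<Sum>i\<in>I. f (w i)) \<partial>Pi\<^sub>M I (\<lambda>_. M)) = real (card I) * expectation f"
    by (auto simp: Bochner_Integration.integral_sum)
qed

text \<open>Equality in the arithmetic-geometric mean inequality: at this exponent the entropy and
  variance contributions of \<open>sign_avg_Max_le\<close> coincide.\<close>

lemma optimal_exponent:
  fixes L v :: real
  assumes "L > 0" "v > 0"
  shows "L / sqrt (2 * L / v) + sqrt (2 * L / v) * v / 2 = sqrt (2 * L * v)"
proof -
  define l where "l = sqrt (2 * L / v)"
  have l: "l > 0" using assms by (simp add: l_def)
  have "l * l = 2 * L / v" using assms by (simp add: l_def)
  then have "L = l * l * v / 2" using assms by (simp add: field_simps)
  then have 1: "L / l = l * v / 2" using l by (simp add: field_simps)
  have "l * v = sqrt (2 * L / v) * sqrt (v * v)" using assms by (simp add: l_def)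
  also have "\<dots> = sqrt (2 * L / v * (v * v))" by (rule real_sqrt_mult[symmetric])
  also have "2 * L / v * (v * v) = 2 * L * v" using assms by simp
  finally have "l * v = sqrt (2 * L * v)" .
  moreover have "L / l + l * v / 2 = l * v" unfolding 1 by simp
  ultimately show ?thesis unfolding l_def[symmetric] by simp
qed

lemma abs_cos_diff_le: "\<bar>cos a - cos b\<bar> \<le> \<bar>a - b\<bar>" for a b :: real
proof -
  have "\<bar>cos a - cos b\<bar> = 2 * \<bar>sin ((a + b) / 2)\<bar> * \<bar>sin ((b - a) / 2)\<bar>"
    by (simp add: cos_diff_cos abs_mult)
  also have "\<dots> \<le> 2 * 1 * \<bar>(b - a) / 2\<bar>"
    by (intro mult_mono abs_sin_x_le_abs_x) auto
  finally show ?thesis by (simp add: abs_minus_commute)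
qed

lemma sum_half_powers: "(\<Sum>k<K. (1/2)^k) \<le> (2::real)"
proof -
  have "(\<Sum>k<K. (1/2)^k) = 2 - 2 * (1/2::real)^K" by (induction K) auto
  then show ?thesis by simp
qed

lemma sum_linear_half_powers: "(\<Sum>k<K. (real k + 2) * (1/2)^k) \<le> 6"
proof -
  have "(\<Sum>k<K. (real k + 2) * (1/2)^k) = 6 - (2 * real K + 6) * (1/2)^K"
    by (induction K) (auto simp: algebra_simps)
  then show ?thesis by simp
qed

section \<open>The centred cosine process\<close>

locale frequency_distribution = prob_space L for L :: "'a::euclidean_space measure" +
  assumes sets_L [measurable_cong]: "sets L = sets borel"
    and second_moment: "integrable L (\<lambda>\<omega>. (norm \<omega>)\<^sup>2)"
begin

text \<open>The contribution of one frequency to the error at the displacement \<open>z\<close>,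
  once Bochner's theorem identifies the expectation with the kernel.\<close>

definition cosc :: "'a \<Rightarrow> 'a \<Rightarrow> real" where
  "cosc z \<omega> = cos (\<omega> \<bullet> z) - expectation (\<lambda>\<omega>. cos (\<omega> \<bullet> z))"

definition sigma :: real where "sigma = sqrt (expectation (\<lambda>\<omega>. (norm \<omega>)\<^sup>2))"

definition mean_norm :: real where "mean_norm = expectation norm"

lemma integrable_norm_L: "integrable L norm"
proof (rule Bochner_Integration.integrable_bound[where f="\<lambda>\<omega>. 1 + (norm \<omega>)\<^sup>2"])
  show "AE x in L. norm (norm x) \<le> norm (1 + (norm x)\<^sup>2)"
  proof (rule AE_I2)
    fix x :: 'a
    have "0 \<le> (norm x - 1)\<^sup>2 + (norm x)\<^sup>2 + 1" by simp
    then show "norm (norm x) \<le> norm (1 + (norm x)\<^sup>2)" by (simp add: power2_eq_square algebra_simps)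
  qed
qed (use second_moment in auto)

lemma sigma_nonneg: "sigma \<ge> 0" by (simp add: sigma_def)

lemma sigma_square: "sigma\<^sup>2 = expectation (\<lambda>\<omega>. (norm \<omega>)\<^sup>2)" by (simp add: sigma_def)

lemma mean_norm_nonneg: "mean_norm \<ge> 0" by (simp add: mean_norm_def)

lemma mean_norm_le: "mean_norm\<^sup>2 \<le> sigma\<^sup>2"
  using variance_eq[OF integrable_norm_L second_moment] variance_positive[of norm]
  by (simp add: sigma_square mean_norm_def)

lemma cos_integrable: "integrable L (\<lambda>\<omega>. cos (\<omega> \<bullet> z))"
  by (rule integrable_const_bound[where B=1]) auto

lemma cosc_measurable [measurable]: "cosc z \<in> borel_measurable L"
  unfolding cosc_def[abs_def] by measurable

lemma abs_expectation_cos_le: "\<bar>expectation (\<lambda>\<omega>. cos (\<omega> \<bullet> z))\<bar> \<le> 1"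
proof -
  have "\<bar>expectation (\<lambda>\<omega>. cos (\<omega> \<bullet> z))\<bar> \<le> expectation (\<lambda>\<omega>. \<bar>cos (\<omega> \<bullet> z)\<bar>)" by (rule integral_abs_bound)
  also have "\<dots> \<le> expectation (\<lambda>\<omega>. 1)"
    by (intro integral_mono integrable_abs cos_integrable) auto
  finally show ?thesis by (simp add: prob_space)
qed

lemma abs_cosc_le: "\<bar>cosc z \<omega>\<bar> \<le> 2"
  using abs_expectation_cos_le[of z] abs_cos_le_one[of "\<omega> \<bullet> z"] unfolding cosc_def by linarith

text \<open>The centring terms cancel, so the oscillation is 2 although the uniform bound
  \<open>abs_cosc_le\<close> only gives 4. This is the source of the difference 2/m and hence of the
  term sqrt (2 tau).\<close>

lemma cosc_osc: "\<bar>cosc z \<omega> - cosc z \<omega>'\<bar> \<le> 2"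
  using abs_cos_le_one[of "\<omega> \<bullet> z"] abs_cos_le_one[of "\<omega>' \<bullet> z"] unfolding cosc_def by linarith

lemma expectation_cosc: "expectation (cosc z) = 0"
  using cos_integrable[of z] by (simp add: cosc_def[abs_def] prob_space)

text \<open>\<open>norm \<omega>\<close> comes from the cosine and \<open>mean_norm\<close> from its
  expectation. The constant depends on the frequency but not on the two points, as chaining
  requires.\<close>

lemma cosc_lipschitz: "\<bar>cosc z \<omega> - cosc z' \<omega>\<bar> \<le> dist z z' * (norm \<omega> + mean_norm)"
proof -
  have c: "\<bar>cos (\<omega> \<bullet> z) - cos (\<omega> \<bullet> z')\<bar> \<le> dist z z' * norm \<omega>" for \<omega>
  proof -
    have "\<bar>cos (\<omega> \<bullet> z) - cos (\<omega> \<bullet> z')\<bar> \<le> \<bar>\<omega> \<bullet> (z - z')\<bar>"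
      using abs_cos_diff_le[of "\<omega> \<bullet> z" "\<omega> \<bullet> z'"] by (simp add: inner_diff_right)
    also have "\<dots> \<le> norm \<omega> * norm (z - z')" by (rule Cauchy_Schwarz_ineq2)
    finally show ?thesis by (simp add: dist_norm mult.commute)
  qed
  have "\<bar>expectation (\<lambda>\<omega>. cos (\<omega> \<bullet> z)) - expectation (\<lambda>\<omega>. cos (\<omega> \<bullet> z'))\<bar> = \<bar>expectation (\<lambda>\<omega>. cos (\<omega> \<bullet> z) - cos (\<omega> \<bullet> z'))\<bar>"
    using cos_integrable by simp
  also have "\<dots> \<le> expectation (\<lambda>\<omega>. \<bar>cos (\<omega> \<bullet> z) - cos (\<omega> \<bullet> z')\<bar>)" by (rule integral_abs_bound)
  also have "\<dots> \<le> expectation (\<lambda>\<omega>. dist z z' * norm \<omega>)"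
    using cos_integrable integrable_norm_L by (intro integral_mono integrable_abs) (auto intro: c)
  finally have "\<bar>expectation (\<lambda>\<omega>. cos (\<omega> \<bullet> z)) - expectation (\<lambda>\<omega>. cos (\<omega> \<bullet> z'))\<bar> \<le> dist z z' * mean_norm"
    by (simp add: mean_norm_def)
  with c[of \<omega>] show ?thesis unfolding cosc_def by (simp add: distrib_left)
qed

text \<open>Expanding gives sigma^2 + 3 mean_norm^2, and the mean norm is at most sigma. The factor
  4 equals the square of the uniform bound 2, so the start and the links of the chain share one
  variance scale.\<close>

lemma second_moment_shift:
  "integrable L (\<lambda>\<omega>. (norm \<omega> + mean_norm)\<^sup>2)" "expectation (\<lambda>\<omega>. (norm \<omega> + mean_norm)\<^sup>2) \<le> 4 * sigma\<^sup>2"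
proof -
  have e: "(\<lambda>\<omega>::'a. (norm \<omega> + mean_norm)\<^sup>2) = (\<lambda>\<omega>. (norm \<omega>)\<^sup>2 + (2 * mean_norm * norm \<omega> + mean_norm\<^sup>2))"
    by (simp add: power2_eq_square algebra_simps fun_eq_iff)
  have i: "integrable L (\<lambda>\<omega>. 2 * mean_norm * norm \<omega> + mean_norm\<^sup>2)" using integrable_norm_L by simp
  show "integrable L (\<lambda>\<omega>. (norm \<omega> + mean_norm)\<^sup>2)" unfolding e using second_moment i by simp
  have "expectation (\<lambda>\<omega>. (norm \<omega> + mean_norm)\<^sup>2) = sigma\<^sup>2 + (2 * mean_norm * mean_norm + mean_norm\<^sup>2)"
    unfolding e using second_moment i integrable_norm_L by (simp add: sigma_square mean_norm_def[symmetric] prob_space)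
  also have "\<dots> \<le> 4 * sigma\<^sup>2" using mean_norm_le by (simp add: power2_eq_square)
  finally show "expectation (\<lambda>\<omega>. (norm \<omega> + mean_norm)\<^sup>2) \<le> 4 * sigma\<^sup>2" .
qed

lemma centred_process_cosc:
  assumes "countable Q" "Q \<noteq> {}"
  shows "centred_empirical_process L Q cosc 2"
  by unfold_locales (use assms abs_cosc_le expectation_cosc in auto)

text \<open>The comparison holds for each fixed sign pattern and hence for their average. Exchanging
  the average with the integral leaves a pure sign average for each sample, which chaining can
  bound.\<close>

lemma expected_sup_symmetrized:
  fixes I :: "'i set"
  assumes Q: "countable Q" "Q \<noteq> {}" and I: "finite I"
  shows "(\<integral>w. emp_sup Q cosc I (\<lambda>_. 1) w \<partial>Pi\<^sub>M I (\<lambda>_. L))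
    \<le> 2 * (\<integral>w. sign_avg I (\<lambda>U. emp_sup Q cosc I (sgn_of U) w) \<partial>Pi\<^sub>M I (\<lambda>_. L))"
    and "integrable (Pi\<^sub>M I (\<lambda>_. L)) (\<lambda>w. sign_avg I (\<lambda>U. emp_sup Q cosc I (sgn_of U) w))"
proof -
  interpret C: centred_empirical_process L Q cosc 2 by (rule centred_process_cosc[OF Q])
  let ?P = "Pi\<^sub>M I (\<lambda>_. L)"
  let ?E = "\<integral>w. emp_sup Q cosc I (\<lambda>_. 1) w \<partial>?P"
  have i: "integrable ?P (emp_sup Q cosc I c)" for c by (rule C.emp_sup_integrable[OF order_refl])
  then show "integrable ?P (\<lambda>w. sign_avg I (\<lambda>U. emp_sup Q cosc I (sgn_of U) w))"
    unfolding sign_avg_def by simp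
  have "?E = sign_avg I (\<lambda>U. ?E)" by (rule sign_avg_const[OF I, symmetric])
  also have "\<dots> \<le> sign_avg I (\<lambda>U. 2 * (\<integral>w. emp_sup Q cosc I (sgn_of U) w \<partial>?P))"
    by (rule sign_avg_mono[OF C.expectation_emp_sup_signs[OF I]])
  also have "\<dots> = 2 * sign_avg I (\<lambda>U. \<integral>w. emp_sup Q cosc I (sgn_of U) w \<partial>?P)" by (rule sign_avg_cmult)
  also have "sign_avg I (\<lambda>U. \<integral>w. emp_sup Q cosc I (sgn_of U) w \<partial>?P) = (\<integral>w. sign_avg I (\<lambda>U. emp_sup Q cosc I (sgn_of U) w) \<partial>?P)"
    unfolding sign_avg_def using i by (simp add: Bochner_Integration.integral_sum)
  finally show "?E \<le> 2 * (\<integral>w. sign_avg I (\<lambda>U. emp_sup Q cosc I (sgn_of U) w) \<partial>?P)" .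
qed

text \<open>The estimate 1 + 2^k 2D (1 + sigma) <= 2^k (2D + 1)(sigma + 1) splits the entropy into
  the two logarithms of \<open>rff_h\<close> and a term linear in \<open>k\<close>. The factor 2 in
  front of \<open>N\<close> is absorbed by ln 2 <= d, which gives k + 1 in place of k.\<close>

lemma log_covering_bound:
  fixes N D :: real
  assumes D: "D > 0" and N: "N \<ge> 1" "N \<le> (1 + 2 * D / ((1/2)^k / (1 + sigma))) ^ DIM('a)"
  shows "sqrt (ln (2 * N)) \<le> sqrt DIM('a) * (sqrt (ln (2 * D + 1)) + sqrt (ln (sigma + 1)) + (real k + 1))"
proof -
  define d where "d = real DIM('a)"
  have d: "d \<ge> 1" by (simp add: d_def Suc_leI)
  have A: "ln (2 * D + 1) \<ge> 0" and Bn: "ln (sigma + 1) \<ge> 0" using D sigma_nonneg by simp_all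
  have "1 + 2 * D / ((1/2)^k / (1 + sigma)) = 1 + 2 ^ k * (2 * D * (1 + sigma))"
    by (simp add: power_divide)
  also have "\<dots> \<le> 2 ^ k * (1 + 2 * D * (1 + sigma))" by (simp add: distrib_left)
  also have "\<dots> \<le> 2 ^ k * ((2 * D + 1) * (sigma + 1))"
    using sigma_nonneg by (intro mult_left_mono) (auto simp: algebra_simps)
  finally have b: "1 + 2 * D / ((1/2)^k / (1 + sigma)) \<le> 2 ^ k * ((2 * D + 1) * (sigma + 1))" .
  have pos: "0 < 1 + 2 * D / ((1/2)^k / (1 + sigma))" using D sigma_nonneg by (simp add: add_pos_nonneg)
  have "ln N \<le> ln ((1 + 2 * D / ((1/2)^k / (1 + sigma))) ^ DIM('a))" using N by simp
  also have "\<dots> = d * ln (1 + 2 * D / ((1/2)^k / (1 + sigma)))" using pos by (simp add: ln_realpow d_def)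
  also have "\<dots> \<le> d * ln (2 ^ k * ((2 * D + 1) * (sigma + 1)))"
    using b pos d by (intro mult_left_mono) auto
  also have "ln (2 ^ k * ((2 * D + 1) * (sigma + 1))) = real k * ln 2 + (ln (2 * D + 1) + ln (sigma + 1))"
    using D sigma_nonneg by (simp add: ln_mult ln_realpow)
  also have "\<dots> \<le> real k + (ln (2 * D + 1) + ln (sigma + 1))"
    using ln_2_less_1 by (intro add_right_mono) (simp add: mult_left_le)
  finally have lnN: "ln N \<le> d * (real k + (ln (2 * D + 1) + ln (sigma + 1)))" using d by simp
  have "ln (2 * N) = ln 2 + ln N" using N by (simp add: ln_mult)
  also have "\<dots> \<le> d * 1 + d * (real k + (ln (2 * D + 1) + ln (sigma + 1)))"
    using lnN ln_2_less_1 d by linarith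
  also have "\<dots> = d * (ln (2 * D + 1) + ln (sigma + 1) + (real k + 1))" by (simp add: algebra_simps)
  finally have "sqrt (ln (2 * N)) \<le> sqrt d * sqrt (ln (2 * D + 1) + ln (sigma + 1) + (real k + 1))"
    by (simp flip: real_sqrt_mult)
  also have "\<dots> \<le> sqrt d * (sqrt (ln (2 * D + 1)) + sqrt (ln (sigma + 1)) + sqrt (real k + 1))"
  proof (intro mult_left_mono)
    show "sqrt (ln (2 * D + 1) + ln (sigma + 1) + (real k + 1)) \<le> sqrt (ln (2 * D + 1)) + sqrt (ln (sigma + 1)) + sqrt (real k + 1)"
      using sqrt_add_le_add_sqrt[of "ln (2 * D + 1) + ln (sigma + 1)" "real k + 1"]
        sqrt_add_le_add_sqrt[OF A Bn] A Bn by linarith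
  qed (use d in simp)
  \<comment> \<open>Replacing sqrt (k + 1) by k + 1 is crude, but the series against (1/2)^k then
    has a closed form.\<close>
  also have "\<dots> \<le> sqrt d * (sqrt (ln (2 * D + 1)) + sqrt (ln (sigma + 1)) + (real k + 1))"
  proof (intro mult_left_mono add_left_mono)
    show "sqrt (real k + 1) \<le> real k + 1"
      by (rule real_le_lsqrt) (auto simp: power2_eq_square algebra_simps)
  qed (use d in simp)
  finally show ?thesis by (simp add: d_def)
qed

lemma expected_sign_avg_chaining:
  fixes I :: "'i set"
  assumes I: "finite I" and Q: "countable Q" "Q \<noteq> {}" "Q \<subseteq> S"
    and T: "\<And>k. finite (T k)" "\<And>k. T k \<noteq> {}" "\<And>k. T k \<subseteq> S"
    and cover: "\<And>k z. z \<in> S \<Longrightarrow> \<exists>t\<in>T k. dist z t \<le> \<delta> k"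
    and l: "\<And>k. l k > 0"
  shows "(\<integral>w. sign_avg I (\<lambda>U. emp_sup Q cosc I (sgn_of U) w) \<partial>Pi\<^sub>M I (\<lambda>_. L))
    \<le> ln (2 * real (card (T 0))) / l 0 + l 0 * (4 * real (card I)) / 2
      + (\<Sum>k<K. ln (2 * real (card (T (Suc k)))) / l (Suc k) + l (Suc k) * (4 * real (card I) * (sigma * \<delta> k)\<^sup>2) / 2)
      + \<delta> K * (real (card I) * (2 * mean_norm))"
proof -
  let ?P = "Pi\<^sub>M I (\<lambda>_. L)"
  interpret P: prob_space ?P by (intro prob_space_PiM prob_space_axioms)
  define W where "W w = (\<Sum>i\<in>I. (norm (w i) + mean_norm)\<^sup>2)" for w :: "'i \<Rightarrow> 'a"
  define N where "N w = (\<Sum>i\<in>I. norm (w i) + mean_norm)" for w :: "'i \<Rightarrow> 'a"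
  define C where "C = ln (2 * real (card (T 0))) / l 0 + l 0 * (real (card I) * 2\<^sup>2) / 2"
  define a where "a k = ln (2 * real (card (T (Suc k)))) / l (Suc k)" for k
  define b where "b k = l (Suc k) * (\<delta> k)\<^sup>2 / 2" for k
  have b: "b k \<ge> 0" for k using l[of "Suc k"] by (simp add: b_def)
  have iW: "integrable ?P W" unfolding W_def by (rule expectation_sum_PiM(1)[OF second_moment_shift(1) I])
  have EW: "(\<integral>w. W w \<partial>?P) \<le> real (card I) * (4 * sigma\<^sup>2)"
    unfolding W_def expectation_sum_PiM(2)[OF second_moment_shift(1) I]
    by (intro mult_left_mono second_moment_shift(2)) simp
  have nm: "integrable L (\<lambda>\<omega>. norm \<omega> + mean_norm)" using integrable_norm_L by simp
  have iN: "integrable ?P N" unfolding N_def by (rule expectation_sum_PiM(1)[OF nm I])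
  have EN: "(\<integral>w. N w \<partial>?P) = real (card I) * (2 * mean_norm)"
    unfolding N_def expectation_sum_PiM(2)[OF nm I]
    using integrable_norm_L by (simp add: mean_norm_def[symmetric] prob_space)
  \<comment> \<open>The sample enters only through the squared and plain sums \<open>W\<close> and
    \<open>N\<close> of the Lipschitz constants, both linearly, so integration needs only their
    means.\<close>
  have pw: "sign_avg I (\<lambda>U. emp_sup Q cosc I (sgn_of U) w) \<le> (C + sum a {..<K}) + sum b {..<K} * W w + \<delta> K * N w" for w
  proof -
    have "sign_avg I (\<lambda>U. SUP z\<in>Q. \<bar>\<Sum>i\<in>I. sgn_of U i * cosc z (w i)\<bar>)
      \<le> C + (\<Sum>k<K. ln (2 * real (card (T (Suc k)))) / l (Suc k) + l (Suc k) * ((\<delta> k)\<^sup>2 * W w) / 2) + \<delta> K * N w"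
      unfolding C_def W_def N_def
      by (rule dyadic_chaining[OF I T cover _ _ _ l Q(3,2)])
         (use abs_cosc_le cosc_lipschitz mean_norm_nonneg in auto)
    also have "(\<Sum>k<K. ln (2 * real (card (T (Suc k)))) / l (Suc k) + l (Suc k) * ((\<delta> k)\<^sup>2 * W w) / 2) = sum a {..<K} + sum b {..<K} * W w"
      unfolding a_def b_def sum.distrib sum_distrib_right by (intro arg_cong2[where f="(+)"] sum.cong) auto
    finally show ?thesis by (simp add: emp_sup_def add.assoc)
  qed
  have "(\<integral>w. sign_avg I (\<lambda>U. emp_sup Q cosc I (sgn_of U) w) \<partial>?P) \<le> (\<integral>w. (C + sum a {..<K}) + sum b {..<K} * W w + \<delta> K * N w \<partial>?P)"
    by (rule integral_mono[OF expected_sup_symmetrized(2)[OF Q(1,2) I]]) (use iW iN pw in auto)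
  also have "\<dots> = (C + sum a {..<K}) + sum b {..<K} * (\<integral>w. W w \<partial>?P) + \<delta> K * (\<integral>w. N w \<partial>?P)"
    using iW iN by (simp add: P.prob_space)
  also have "\<dots> \<le> (C + sum a {..<K}) + sum b {..<K} * (real (card I) * (4 * sigma\<^sup>2)) + \<delta> K * (real (card I) * (2 * mean_norm))"
    unfolding EN by (intro add_right_mono add_left_mono mult_left_mono sum_nonneg EW b)
  also have "\<dots> = C + (\<Sum>k<K. a k + l (Suc k) * (4 * real (card I) * (sigma * \<delta> k)\<^sup>2) / 2) + \<delta> K * (real (card I) * (2 * mean_norm))"
    unfolding b_def sum.distrib sum_distrib_right power_mult_distrib by (simp add: mult_ac)
  finally show ?thesis by (simp add: C_def a_def mult.commute)
qed

theorem expected_sup_le: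
  fixes I :: "'i set" and Q :: "'a set"
  assumes I: "finite I" "I \<noteq> {}" and D: "D > 0" and Q: "countable Q" "Q \<noteq> {}" "Q \<subseteq> cball 0 D"
  shows "(\<integral>w. emp_sup Q cosc I (\<lambda>_. 1) w \<partial>Pi\<^sub>M I (\<lambda>_. L))
    \<le> sqrt (real (card I)) * (sqrt (2 * real DIM('a)) * (12 * sqrt (ln (2 * D + 1)) + 12 * sqrt (ln (sigma + 1)) + 28))"
proof -
  define m where "m = real (card I)"
  have m: "m > 0" using I by (simp add: m_def card_gt_0_iff)
  define s where "s = 1 + sigma"
  have s: "s > 0" "sigma \<le> s" using sigma_nonneg by (auto simp: s_def)
  \<comment> \<open>The scale 1/(1 + sigma) gives sigma times the mesh at most (1/2)^k, and it stays
    defined when sigma is 0. The diameter then enters only through the cardinality of the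
    nets.\<close>
  define \<delta> where "\<delta> k = (1/2)^k / s" for k :: nat
  have d0: "\<delta> k > 0" for k using s by (simp add: \<delta>_def)
  have "\<exists>T::'a set. finite T \<and> T \<noteq> {} \<and> T \<subseteq> cball 0 D \<and> (\<forall>z\<in>cball 0 D. \<exists>t\<in>T. dist z t \<le> \<delta> k)
      \<and> real (card T) \<le> (1 + 2 * D / \<delta> k) ^ DIM('a)" for k
    using cball_net[OF less_imp_le[OF D] d0[of k]] by metis
  then obtain T where T: "\<And>k. finite (T k)" "\<And>k. T k \<noteq> {}" "\<And>k. T k \<subseteq> cball (0::'a) D"
      "\<And>k z. z \<in> cball 0 D \<Longrightarrow> \<exists>t\<in>T k. dist z t \<le> \<delta> k"
      "\<And>k. real (card (T k)) \<le> (1 + 2 * D / \<delta> k) ^ DIM('a)" by metis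
  define c where "c = sqrt (ln (2 * D + 1)) + sqrt (ln (sigma + 1))"
  have cpos: "c \<ge> 0" using D sigma_nonneg by (simp add: c_def)
  define Ln where "Ln k = ln (2 * real (card (T k)))" for k
  have cT: "real (card (T k)) \<ge> 1" for k using T(1,2)[of k] by (simp add: Suc_leI card_gt_0_iff)
  have Ln: "Ln k > 0" for k using cT[of k] by (simp add: Ln_def)
  have Lb: "sqrt (Ln k) \<le> sqrt DIM('a) * (c + (real k + 1))" for k
    unfolding Ln_def c_def using log_covering_bound[OF D cT, of k k] T(5)[of k] by (simp add: \<delta>_def s_def)
  \<comment> \<open>Relative size of the chain increments. Level 0 is the uniformly bounded start,
    of size 1; level \<open>Suc j\<close> links \<open>T (Suc j)\<close> to \<open>T j\<close>
    across the mesh of \<open>T j\<close>, whence the shift in the exponent.\<close>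
  define r where "r k = (case k of 0 \<Rightarrow> 1 | Suc j \<Rightarrow> (1/2::real)^j)" for k :: nat
  have r: "r k > 0" for k by (simp add: r_def split: nat.split)
  define v where "v k = 4 * m * (r k)\<^sup>2" for k
  have v: "v k > 0" for k using m r[of k] by (simp add: v_def)
  \<comment> \<open>The optimal exponent for the mean variance bound \<open>v k\<close>; it is
    independent of the sample.\<close>
  define l where "l k = sqrt (2 * Ln k / v k)" for k
  have l: "l k > 0" for k using Ln[of k] v[of k] by (simp add: l_def)
  have opt: "Ln k / l k + l k * v k / 2 \<le> 2 * sqrt (2 * m) * (r k * (sqrt DIM('a) * (c + (real k + 1))))" for k
  proof -
    have "Ln k / l k + l k * v k / 2 = sqrt (2 * Ln k * v k)"
      unfolding l_def by (rule optimal_exponent[OF Ln v])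
    also have "2 * Ln k * v k = (2 * r k)\<^sup>2 * (2 * m) * Ln k" by (simp add: v_def power_mult_distrib)
    also have "sqrt \<dots> = 2 * r k * sqrt (2 * m) * sqrt (Ln k)"
      unfolding real_sqrt_mult real_sqrt_abs using r[of k] by simp
    also have "\<dots> \<le> 2 * r k * sqrt (2 * m) * (sqrt DIM('a) * (c + (real k + 1)))"
      using r[of k] m by (intro mult_left_mono Lb) auto
    finally show ?thesis by (simp add: mult_ac)
  qed
  let ?E = "\<integral>w. emp_sup Q cosc I (\<lambda>_. 1) w \<partial>Pi\<^sub>M I (\<lambda>_. L)"
  \<comment> \<open>Twice the expected remainder beyond the finest net is R times (1/2)^K; it
    disappears as \<open>K\<close> tends to infinity, since the left side does not depend on
    \<open>K\<close>.\<close>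
  define R where "R = 2 * (m * (2 * mean_norm)) / s"
  let ?B = "4 * sqrt (2 * m) * sqrt DIM('a) * (3 * c + 7)"
  have bound: "?E \<le> ?B + R * (1/2)^K" for K
  proof -
    have "?E \<le> 2 * (\<integral>w. sign_avg I (\<lambda>U. emp_sup Q cosc I (sgn_of U) w) \<partial>Pi\<^sub>M I (\<lambda>_. L))"
      by (rule expected_sup_symmetrized(1)[OF Q(1,2) I(1)])
    also have "\<dots> \<le> 2 * (Ln 0 / l 0 + l 0 * (4 * m) / 2
      + (\<Sum>k<K. Ln (Suc k) / l (Suc k) + l (Suc k) * (4 * m * (sigma * \<delta> k)\<^sup>2) / 2)
      + \<delta> K * (m * (2 * mean_norm)))"
      unfolding Ln_def m_def
      by (intro mult_left_mono expected_sign_avg_chaining[OF I(1) Q T(1,2,3,4) l]) auto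
    also have "\<dots> \<le> 2 * ((Ln 0 / l 0 + l 0 * v 0 / 2)
      + (\<Sum>k<K. Ln (Suc k) / l (Suc k) + l (Suc k) * v (Suc k) / 2)
      + \<delta> K * (m * (2 * mean_norm)))"
    proof (intro mult_left_mono add_mono sum_mono order_refl)
      show "l 0 * (4 * m) / 2 \<le> l 0 * v 0 / 2" by (simp add: v_def r_def)
      fix k
      have "sigma * \<delta> k \<le> s * \<delta> k" using d0[of k] s by (intro mult_right_mono) auto
      also have "\<dots> = r (Suc k)" using s by (simp add: \<delta>_def r_def)
      finally have "(sigma * \<delta> k)\<^sup>2 \<le> (r (Suc k))\<^sup>2"
        using sigma_nonneg d0[of k] by (intro power_mono) auto
      then show "l (Suc k) * (4 * m * (sigma * \<delta> k)\<^sup>2) / 2 \<le> l (Suc k) * v (Suc k) / 2"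
        unfolding v_def using l[of "Suc k"] m by (intro divide_right_mono mult_left_mono) auto
    qed (use m less_imp_le[OF d0] in auto)
    also have "\<dots> \<le> 2 * (2 * sqrt (2 * m) * (r 0 * (sqrt DIM('a) * (c + (real 0 + 1))))
      + (\<Sum>k<K. 2 * sqrt (2 * m) * (r (Suc k) * (sqrt DIM('a) * (c + (real (Suc k) + 1)))))
      + \<delta> K * (m * (2 * mean_norm)))"
      by (intro mult_left_mono add_mono sum_mono order_refl opt) simp
    \<comment> \<open>The start contributes c + 1 and the links at most 2c + 6, together 3c + 7; the
      prefactor 4 then produces 12 and 28.\<close>
    also have "\<dots> = 4 * sqrt (2 * m) * sqrt DIM('a) * ((c + 1) + (c * (\<Sum>k<K. (1/2)^k) + (\<Sum>k<K. (real k + 2) * (1/2)^k)))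
       + R * (1/2)^K"
      by (simp add: r_def R_def \<delta>_def sum_distrib_left sum_distrib_right sum.distrib[symmetric] algebra_simps)
    also have "\<dots> \<le> 4 * sqrt (2 * m) * sqrt DIM('a) * ((c + 1) + (c * 2 + 6)) + R * (1/2)^K"
      using cpos m by (intro add_right_mono mult_left_mono add_left_mono add_mono sum_half_powers sum_linear_half_powers) auto
    also have "(c + 1) + (c * 2 + 6) = 3 * c + 7" by simp
    finally show ?thesis .
  qed
  have "(\<lambda>K. ?B + R * (1/2)^K) \<longlonglongrightarrow> ?B + R * 0"
    by (intro tendsto_intros LIMSEQ_realpow_zero) auto
  then have "?E \<le> ?B + R * 0"
    by (rule LIMSEQ_le_const) (use bound in auto)
  also have "\<dots> = sqrt m * (sqrt (2 * real DIM('a)) * (12 * c + 28))"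
    by (simp add: real_sqrt_mult algebra_simps)
  finally show ?thesis by (simp add: m_def c_def algebra_simps)
qed

lemma expected_sup_le_rff_h:
  fixes I :: "'i set" and Q :: "'a set"
  assumes I: "finite I" "I \<noteq> {}" and D: "D > 0" and Q: "countable Q" "Q \<noteq> {}" "Q \<subseteq> cball 0 D"
  shows "(\<integral>w. emp_sup Q cosc I (\<lambda>_. 1) w \<partial>Pi\<^sub>M I (\<lambda>_. L)) \<le> sqrt (real (card I)) * rff_h DIM('a) D sigma"
proof -
  define a where "a = sqrt (ln (2 * D + 1))"
  define b where "b = sqrt (ln (sigma + 1))"
  have a: "a > 0" using D by (simp add: a_def)
  have b: "b \<ge> 0" using sigma_nonneg by (simp add: b_def)
  \<comment> \<open>Expanding 20 (a - 7/10)^2 >= 0 leaves 9.8, which is at most 16. The coefficient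
    20 is what remains of 32 after 12 has been used for the logarithm.\<close>
  have "28 * a \<le> 20 * (a * a) + 16"
    using zero_le_power2[of "a - 7 / 10"] by (simp add: power2_eq_square algebra_simps)
  then have "28 \<le> 20 * a + 16 / a" using a by (simp add: field_simps)
  then have "12 * a + 12 * b + 28 \<le> 32 * a + 32 * b + 16 / a" using b by linarith
  then have "sqrt (2 * real DIM('a)) * (12 * a + 12 * b + 28) \<le> sqrt (2 * real DIM('a)) * (32 * a + 32 * b + 16 / a)"
    by (intro mult_left_mono) auto
  also have "\<dots> = rff_h DIM('a) D sigma"
    unfolding rff_h_def a_def b_def
    by (simp add: real_sqrt_mult real_sqrt_inverse divide_inverse distrib_left)
  finally show ?thesis
    using expected_sup_le[OF assms] unfolding a_def[symmetric] b_def[symmetric]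
    by (meson mult_left_mono order_trans real_sqrt_ge_zero of_nat_0_le_iff)
qed

theorem sup_deviation:
  fixes I :: "'i set" and Q :: "'a set"
  assumes I: "finite I" "I \<noteq> {}" and D: "D > 0" and \<tau>: "\<tau> > 0"
    and Q: "countable Q" "Q \<noteq> {}" "Q \<subseteq> cball 0 D"
  defines "F \<equiv> \<lambda>w. emp_sup Q cosc I (\<lambda>_. 1) w / real (card I)"
  shows "measure (Pi\<^sub>M I (\<lambda>_. L)) {w \<in> space (Pi\<^sub>M I (\<lambda>_. L)).
     (rff_h DIM('a) D sigma + sqrt (2 * \<tau>)) / sqrt (real (card I)) \<le> F w} \<le> exp (- \<tau>)"
    and "F \<in> borel_measurable (Pi\<^sub>M I (\<lambda>_. L))"
proof -
  let ?P = "Pi\<^sub>M I (\<lambda>_. L)"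
  interpret P: prob_space ?P by (intro prob_space_PiM prob_space_axioms)
  interpret C: centred_empirical_process L Q cosc 2 by (rule centred_process_cosc[OF Q(1,2)])
  define m where "m = real (card I)"
  have m: "m > 0" using I by (simp add: m_def card_gt_0_iff)
  have [measurable]: "emp_sup Q cosc I (\<lambda>_. 1) \<in> borel_measurable ?P" by (rule C.emp_sup_measurable[OF order_refl])
  show Fm [measurable]: "F \<in> borel_measurable ?P" unfolding F_def by measurable
  have bd: "\<bar>F w\<bar> \<le> 2" if "w \<in> space ?P" for w
    using C.emp_sup_abs[OF that order_refl, of "\<lambda>_. 1"] m by (simp add: F_def m_def[symmetric] field_simps)
  \<comment> \<open>A one-sided comparison of samples that differ in one coordinate; used in both
    directions it gives the two-sided bounded difference.\<close>
  have step: "emp_sup Q cosc I (\<lambda>_. 1) w' \<le> emp_sup Q cosc I (\<lambda>_. 1) w + 2"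
    if w: "w \<in> space ?P" and i: "i \<in> I" and eq: "\<And>j. j \<noteq> i \<Longrightarrow> w' j = w j" for w w' i
  proof (rule C.emp_sup_least)
    fix z assume z: "z \<in> Q"
    have "(\<Sum>j\<in>I. cosc z (w' j)) - (\<Sum>j\<in>I. cosc z (w j)) = cosc z (w' i) - cosc z (w i)"
      using eq by (simp add: sum.remove[OF I(1) i])
    with cosc_osc[of z "w' i" "w i"] C.emp_sup_upper[OF w order_refl z, of "\<lambda>_. 1"]
    show "\<bar>\<Sum>j\<in>I. 1 * cosc z (w' j)\<bar> \<le> emp_sup Q cosc I (\<lambda>_. 1) w + 2" by simp
  qed
  have diff: "\<bar>F (w(i := x)) - F w\<bar> \<le> 2 / m" if w: "w \<in> space ?P" and i: "i \<in> I" and x: "x \<in> space L" for w i x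
  proof -
    have w': "w(i := x) \<in> space ?P" using w i x by (auto simp: space_PiM PiE_iff extensional_def)
    have "emp_sup Q cosc I (\<lambda>_. 1) (w(i := x)) \<le> emp_sup Q cosc I (\<lambda>_. 1) w + 2"
      by (rule step[OF w i]) simp
    moreover have "emp_sup Q cosc I (\<lambda>_. 1) w \<le> emp_sup Q cosc I (\<lambda>_. 1) (w(i := x)) + 2"
      by (rule step[OF w' i]) simp
    ultimately have "\<bar>emp_sup Q cosc I (\<lambda>_. 1) (w(i := x)) - emp_sup Q cosc I (\<lambda>_. 1) w\<bar> \<le> 2" by linarith
    then show ?thesis
      using m by (simp add: F_def m_def[symmetric] diff_divide_distrib[symmetric] abs_divide divide_right_mono)
  qed
  \<comment> \<open>Chosen so that McDiarmid's exponent 2 t^2 / (m (2/m)^2) = m t^2 / 2 equals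
    tau.\<close>
  define t where "t = sqrt (2 * \<tau>) / sqrt m"
  have t: "t > 0" using \<tau> m by (simp add: t_def)
  have "(\<integral>w. F w \<partial>?P) \<le> sqrt m * rff_h DIM('a) D sigma / m"
    using expected_sup_le_rff_h[OF I D Q] m by (simp add: F_def m_def[symmetric] divide_right_mono)
  also have "\<dots> = rff_h DIM('a) D sigma / sqrt m"
    using m by (simp add: field_simps)
  finally have EF: "(\<integral>w. F w \<partial>?P) + t \<le> (rff_h DIM('a) D sigma + sqrt (2 * \<tau>)) / sqrt m"
    by (simp add: t_def add_divide_distrib)
  have "measure ?P {w \<in> space ?P. (rff_h DIM('a) D sigma + sqrt (2 * \<tau>)) / sqrt m \<le> F w}
      \<le> measure ?P {w \<in> space ?P. (\<integral>w. F w \<partial>?P) + t \<le> F w}"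
    using EF by (intro P.finite_measure_mono) auto
  also have "\<dots> \<le> exp (- 2 * t\<^sup>2 / (m * (2 / m)\<^sup>2))"
    unfolding m_def
    by (rule mcdiarmid[OF prob_space_axioms I Fm _ t bd]) (use diff m in \<open>auto simp: m_def\<close>)
  also have "- 2 * t\<^sup>2 / (m * (2 / m)\<^sup>2) = - \<tau>"
    using m \<tau> by (simp add: t_def power_divide field_simps power2_eq_square)
  finally show "measure ?P {w \<in> space ?P. (rff_h DIM('a) D sigma + sqrt (2 * \<tau>)) / sqrt (real (card I)) \<le> F w} \<le> exp (- \<tau>)"
    by (simp add: m_def)
qed

end

section \<open>From the supremum to the L^r norm\<close>

lemma Lr_norm_on_le:
  fixes f :: "'a::euclidean_space \<Rightarrow> 'a \<Rightarrow> real"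
  assumes r: "r \<ge> 1" and S: "compact S" and f: "\<And>x y. x \<in> S \<Longrightarrow> y \<in> S \<Longrightarrow> \<bar>f x y\<bar> \<le> c" and c: "c \<ge> 0"
  shows "Lr_norm_on r S f \<le> measure lborel S powr (2 / r) * c"
proof -
  define V where "V = measure lborel S"
  have V: "V \<ge> 0" by (simp add: V_def)
  have Sm: "S \<in> sets lborel" using S by (simp add: borel_compact)
  have "integrable lborel (indicator S :: 'a \<Rightarrow> real)"
    by (rule integrable_real_indicator[OF Sm emeasure_compact_finite[OF S]])
  then have i: "integrable lborel (\<lambda>x. indicator S x *\<^sub>R b)" for b :: real by simp
  have vol: "(LINT x:S|lborel. b) = V * b" for b :: real
    using Sm by (simp add: set_lebesgue_integral_def V_def)
  \<comment> \<open>Only the constant majorant has to be integrable: a Bochner integral that does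
    not exist has the value 0, which lies below the nonnegative right side.\<close>
  have inner: "(LINT x:S|lborel. \<bar>f x y\<bar> powr r) \<le> V * c powr r" if "y \<in> S" for y
    unfolding vol[symmetric] unfolding set_lebesgue_integral_def
    by (rule integral_mono'[OF i]) (use f that r in \<open>auto simp: indicator_def intro!: powr_mono2\<close>)
  have nonneg: "0 \<le> (LINT x:S|lborel. \<bar>f x y\<bar> powr r)" for y
    unfolding set_lebesgue_integral_def by (rule Bochner_Integration.integral_nonneg) auto
  have outer: "(LINT y:S|lborel. (LINT x:S|lborel. \<bar>f x y\<bar> powr r)) \<le> V * (V * c powr r)"
    unfolding vol[symmetric] unfolding set_lebesgue_integral_def[of lborel S "\<lambda>y. LINT x:S|lborel. _ x y"] set_lebesgue_integral_def[of lborel S "\<lambda>y. LINT x:S|lborel. c powr r"]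
    by (rule integral_mono'[OF i]) (use inner V in \<open>auto simp: indicator_def vol\<close>)
  have "0 \<le> (LINT y:S|lborel. (LINT x:S|lborel. \<bar>f x y\<bar> powr r))"
    unfolding set_lebesgue_integral_def[of lborel S "\<lambda>y. LINT x:S|lborel. \<bar>f x y\<bar> powr r"]
    by (rule Bochner_Integration.integral_nonneg) (use nonneg in auto)
  then have "Lr_norm_on r S f \<le> (V * (V * c powr r)) powr (1 / r)"
    unfolding Lr_norm_on_def using outer r by (intro powr_mono2) auto
  also have "\<dots> = V powr (2 / r) * c"
    using V c r by (simp add: powr_mult powr_powr powr_add[symmetric] mult.assoc[symmetric] flip: add_divide_distrib)
  finally show ?thesis by (simp add: V_def)
qed

theorem corollary2:
  fixes \<psi> :: "real ^ 'd \<Rightarrow> real"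
    and k :: "real ^ 'd \<Rightarrow> real ^ 'd \<Rightarrow> real"
    and \<Lambda> :: "(real ^ 'd) measure"
    and \<sigma> r \<tau> :: real
    and m :: nat
    and S :: "(real ^ 'd) set"
  assumes "\<And>x y. k x y = \<psi> (x - y)"
    and "bounded (range \<psi>)"
    and "continuous_on UNIV \<psi>"
    and "positive_definite \<psi>"
    and "\<psi> 0 = 1"
    and "bochner_measure \<psi> \<Lambda>"
    and "integrable \<Lambda> (\<lambda>\<omega>. (norm \<omega>)\<^sup>2)"
    and "\<sigma> = sqrt (LINT \<omega>|\<Lambda>. (norm \<omega>)\<^sup>2)"
    and "m \<ge> 1"
    and "r \<ge> 1"
    and "\<tau> > 0"
    and "compact S"
    and "S \<noteq> {}"
    and "diameter S > 0"
  shows "measure (Pi\<^sub>M {1..m} (\<lambda>_. \<Lambda>))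
     {\<omega> \<in> space (Pi\<^sub>M {1..m} (\<lambda>_. \<Lambda>)).
        Lr_norm_on r S (\<lambda>x y. rff m \<omega> x y - k x y) \<ge>
          (pi powr (real CARD('d) / 2) * diameter S ^ CARD('d) /
            (2 ^ CARD('d) * Gamma (real CARD('d) / 2 + 1))) powr (2 / r) *
          ((rff_h CARD('d) (diameter S) \<sigma> + sqrt (2 * \<tau>)) / sqrt (real m))}
     \<le> exp (- \<tau>)"
proof -
  note k = assms(1) and cont = assms(3) and r = assms(10) and S = assms(12)
  have boch: "prob_space \<Lambda>" "sets \<Lambda> = sets borel" "\<And>z. complex_of_real (\<psi> z) = measure_fourier \<Lambda> z"
    using assms(6) by (auto simp: bochner_measure_def)
  interpret frequency_distribution \<Lambda>
    by (intro frequency_distribution.intro frequency_distribution_axioms.intro boch assms(7))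
  define D where "D = diameter S"
  have D: "D > 0" using assms(14) by (simp add: D_def)
  have sig: "sigma = \<sigma>" using assms(8) by (simp add: sigma_def)
  have m: "real m > 0" using assms(9) by simp
  let ?I = "{1..m}"
  let ?P = "Pi\<^sub>M ?I (\<lambda>_. \<Lambda>)"
  interpret P: prob_space ?P by (intro prob_space_PiM prob_space_axioms)
  \<comment> \<open>Real parts of the Bochner identity, which turn the expectation inside
    \<open>cosc\<close> into the kernel.\<close>
  have psi: "\<psi> z = expectation (\<lambda>\<omega>. cos (\<omega> \<bullet> z))" for z
  proof -
    have "integrable \<Lambda> (\<lambda>\<omega>. exp (\<i> * complex_of_real (\<omega> \<bullet> z)))"
      by (rule integrable_const_bound[where B=1]) auto
    then have "Re (measure_fourier \<Lambda> z) = expectation (\<lambda>\<omega>. Re (exp (\<i> * complex_of_real (\<omega> \<bullet> z))))"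
      unfolding measure_fourier_def by (rule integral_Re[symmetric])
    then show ?thesis using boch(3)[of z, symmetric] by (simp add: Re_exp)
  qed
  \<comment> \<open>A countable dense subset of the ball that contains all differences x - y;
    countability secures a measurable supremum.\<close>
  obtain Q :: "(real ^ 'd) set" where Q: "countable Q" "Q \<subseteq> cball 0 D" "cball 0 D \<subseteq> closure Q"
    using separable by metis
  have "0 \<in> closure Q" using Q(3) D by auto
  then have Qne: "Q \<noteq> {}" by auto
  interpret C: centred_empirical_process \<Lambda> Q cosc 2 by (rule centred_process_cosc[OF Q(1) Qne])
  define F where "F w = emp_sup Q cosc ?I (\<lambda>_. 1) w / real (card ?I)" for w :: "nat \<Rightarrow> real ^ 'd"
  have dev: "\<bar>rff m w x y - k x y\<bar> \<le> F w" if w: "w \<in> space ?P" and x: "x \<in> S" and y: "y \<in> S" for w x y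
  proof -
    define z where "z = x - y"
    have "norm z \<le> D" using diameter_bounded_bound[OF compact_imp_bounded[OF S] x y] by (simp add: z_def D_def dist_norm)
    then have z: "z \<in> closure Q" using Q(3) by auto
    \<comment> \<open>Continuity of the expectation term is that of \<open>\<psi>\<close>. It
      carries the bound from \<open>Q\<close> to its closure, hence to every displacement in the
      ball.\<close>
    have "continuous_on UNIV (\<lambda>z. \<bar>\<Sum>i\<in>?I. cosc z (w i)\<bar>)"
      unfolding cosc_def psi[symmetric] by (intro continuous_intros cont)
    then have "closed {z. \<bar>\<Sum>i\<in>?I. cosc z (w i)\<bar> \<le> emp_sup Q cosc ?I (\<lambda>_. 1) w}"
      by (intro closed_Collect_le) auto
    moreover have "Q \<subseteq> {z. \<bar>\<Sum>i\<in>?I. cosc z (w i)\<bar> \<le> emp_sup Q cosc ?I (\<lambda>_. 1) w}"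
      using C.emp_sup_upper[OF w order_refl, of _ "\<lambda>_. 1"] by auto
    ultimately have "closure Q \<subseteq> {z. \<bar>\<Sum>i\<in>?I. cosc z (w i)\<bar> \<le> emp_sup Q cosc ?I (\<lambda>_. 1) w}"
      by (intro closure_minimal)
    with z have "\<bar>\<Sum>i\<in>?I. cosc z (w i)\<bar> \<le> emp_sup Q cosc ?I (\<lambda>_. 1) w" by auto
    moreover have "rff m w x y - k x y = (\<Sum>i\<in>?I. cosc z (w i)) / real m"
      using m by (simp add: rff_def k cosc_def psi[symmetric] z_def sum_subtractf field_simps)
    ultimately show ?thesis using m by (simp add: F_def abs_divide divide_right_mono)
  qed
  \<comment> \<open>The volume of a ball of radius D/2, since the unit ball has volume pi^(d/2) /
    Gamma (d/2 + 1).\<close>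
  define V where "V = pi powr (real CARD('d) / 2) * D ^ CARD('d) / (2 ^ CARD('d) * Gamma (real CARD('d) / 2 + 1))"
  have Gp: "Gamma (real CARD('d) / 2 + 1) > 0" by (intro Gamma_real_pos) (simp add: add_pos_pos)
  have V0: "V > 0" using D Gp by (simp add: V_def)
  have "measure lborel S \<le> measure lborel (cball (0 :: real ^ 'd) (D / 2))"
    unfolding D_def by (rule isodiametric_inequality) (use S in \<open>auto simp: compact_imp_bounded borel_compact\<close>)
  also have "\<dots> = V"
    using D by (simp add: content_cball unit_ball_vol_def V_def power_divide)
  finally have vol: "measure lborel S \<le> V" .
  have F0: "F w \<ge> 0" if "w \<in> space ?P" for w
    using C.emp_sup_nonneg[OF that order_refl] by (simp add: F_def)
  have Lr: "Lr_norm_on r S (\<lambda>x y. rff m w x y - k x y) \<le> V powr (2 / r) * F w" if w: "w \<in> space ?P" for w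
  proof -
    have "Lr_norm_on r S (\<lambda>x y. rff m w x y - k x y) \<le> measure lborel S powr (2 / r) * F w"
      by (rule Lr_norm_on_le[OF r S dev[OF w] F0[OF w]])
    also have "\<dots> \<le> V powr (2 / r) * F w"
      using vol r by (intro mult_right_mono powr_mono2 F0[OF w]) auto
    finally show ?thesis .
  qed
  let ?t = "(rff_h CARD('d) D \<sigma> + sqrt (2 * \<tau>)) / sqrt (real m)"
  have I: "finite ?I" "?I \<noteq> {}" using assms(9) by auto
  note sd = sup_deviation[OF I D assms(11) Q(1) Qne Q(2), folded F_def[abs_def]]
  have Fm [measurable]: "F \<in> borel_measurable ?P" using sd(2) by (simp add: F_def[abs_def])
  \<comment> \<open>Monotonicity of the measure asks for measurability of the larger event, and that
    follows from the measurability of \<open>F\<close>; positivity of \<open>V\<close> lets the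
    common factor be cancelled.\<close>
  have "measure ?P {w \<in> space ?P. Lr_norm_on r S (\<lambda>x y. rff m w x y - k x y) \<ge> V powr (2 / r) * ?t}
      \<le> measure ?P {w \<in> space ?P. ?t \<le> F w}"
  proof (rule P.finite_measure_mono)
    show "{w \<in> space ?P. Lr_norm_on r S (\<lambda>x y. rff m w x y - k x y) \<ge> V powr (2 / r) * ?t} \<subseteq> {w \<in> space ?P. ?t \<le> F w}"
    proof safe
      fix w assume w: "w \<in> space ?P" and "Lr_norm_on r S (\<lambda>x y. rff m w x y - k x y) \<ge> V powr (2 / r) * ?t"
      with Lr[OF w] have "V powr (2 / r) * ?t \<le> V powr (2 / r) * F w" by linarith
      then show "?t \<le> F w" by (rule mult_left_le_imp_le) (use V0 in simp)
    qed
  qed measurable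
  also have "\<dots> \<le> exp (- \<tau>)"
    using sd(1) by (simp add: F_def sig)
  finally show ?thesis unfolding V_def D_def .
qed

end
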